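(* Let $f\in\mathbb{R}[\mathbf{x}]$ attain its minimum $f^*=\min_{x\in\mathbb{R}^n}f(x)$ on $\mathbb{R}^n$. Let $B$ be a finite set of monomials connected to $1$, let $E=\langle B^+\rangle$ with $f\in\langle E\cdot E\rangle$, and let $G\subset\langle B^+\cdot B^+\rangle\cap I_{min}(f)$. Let $\Lambda^*\in\mathcal{L}_{G,E,\succcurlyeq}$ be generic for $f$ and satisfy the flat extension property $\mathrm{rank}\,H^{B^+}_{\Lambda^*}=\mathrm{rank}\,H^B_{\Lambda^*}=|B|$. Then there is no duality gap, $f^*=f^\mu_{G,E}=f^{sos}_{G,E}$, and $(\ker H^{B^+}_{\Lambda^*})=I_{min}(f)$.
   Context: $\mathbb{R}[\mathbf{x}]=\mathbb{R}[x_1,\dots,x_n]$; $\langle\cdot\rangle$ denotes linear span, $(S)$ the ideal generated by $S$, and $S\cdot S=\{pq\mid p,q\in S\}$. A set $B$ of monomials is connected to $1$ if $1\in B$ and every monomial $m\ne1$ in $B$ can be written $m=x_im'$ for some $i$ and some $m'\in B$. $B^+=B\cup x_1B\cup\dots\cup x_nB$. $I_{min}(f)$ is the ideal of all polynomials vanishing at every $\mathbf{x}^*\in\mathbb{R}^n$ with $f(\mathbf{x}^* )=f^*$. Define $\mathcal{L}_{G,E,\succcurlyeq}=\{\Lambda\in\langle E\cdot E\rangle^*\mid\Lambda(g)=0\ \forall g\in G,\ \Lambda(1)=1,\ \Lambda(p^2)\ge0\ \forall p\in E\}$, $\mathcal{S}_{G,E}=\{p\in\mathbb{R}[\mathbf{x}]\mid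 p=\sum_{i=1}^sh_i^2+h,\ h_i\in E,\ h\in G\}$, $f^\mu_{G,E}=\inf\{\Lambda(f)\mid\Lambda\in\mathcal{L}_{G,E,\succcurlyeq}\}$, $f^{sos}_{G,E}=\sup\{\lambda\in\mathbb{R}\mid f-\lambda\in\mathcal{S}_{G,E}\}$ (sup of the empty set is $-\infty$). For a subspace $E_0\subset E$ and $\Lambda\in\langle E\cdot E\rangle^*$, $H^{E_0}_\Lambda:E_0\to E_0^*$ is $p\mapsto(q\mapsto\Lambda(pq))$, and $\ker H^{E_0}_\Lambda=\{p\in E_0\mid\Lambda(pq)=0\ \forall q\in E_0\}$; for a monomial set $C$, $H^C_\Lambda$ means $H^{\langle C\rangle}_\Lambda$. A form $\Lambda^*\in\mathcal{L}_{G,E,\succcurlyeq}$ is generic for $f$ if $\Lambda^*(f)=f^\mu_{G,E}$ and $\mathrm{rank}\,H^E_{\Lambda^*}$ is maximal among all $\mathrm{rank}\,H^E_\Lambda$ with $\Lambda\in\mathcal{L}_{G,E,\succcurlyeq}$, $\Lambda(f)=f^\mu_{G,E}$.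
   Formalization: In f^sos the set G is replaced by its linear span, i.e. h ranges over ⟨G⟩; for G a mere subset the claim fails (n=1, f=x², B={1}, G=∅ gives f^sos=−∞ but f*=0). For G a linear subspace the statement is unchanged. *)

theory Defs
  imports
    "HOL-Analysis.Analysis"
    "HOL-Library.Poly_Mapping"
    "HOL-Library.Function_Algebras"
begin

section \<open>Real vector space structures\<close>

instantiation "fun" :: (type, real_vector) real_vector
begin

definition scaleR_fun :: "real \<Rightarrow> ('a \<Rightarrow> 'b) \<Rightarrow> 'a \<Rightarrow> 'b" where
  "scaleR_fun c \<phi> = (\<lambda>x. c *\<^sub>R \<phi> x)"

instance
  by standard (simp_all add: scaleR_fun_def fun_eq_iff scaleR_add_right scaleR_add_left)

end

instantiation poly_mapping :: (type, real_vector) real_vector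
begin

definition scaleR_poly_mapping :: "real \<Rightarrow> ('a \<Rightarrow>\<^sub>0 'b) \<Rightarrow> 'a \<Rightarrow>\<^sub>0 'b" where
  "scaleR_poly_mapping c p = Poly_Mapping.map ((*\<^sub>R) c) p"

lemma lookup_scaleR [simp]:
  "Poly_Mapping.lookup (c *\<^sub>R p) k = c *\<^sub>R Poly_Mapping.lookup (p :: 'a \<Rightarrow>\<^sub>0 'b) k"
  by (simp add: scaleR_poly_mapping_def Poly_Mapping.map.rep_eq when_def)

instance
  by standard
    (simp_all add: poly_mapping_eq_iff fun_eq_iff lookup_add scaleR_add_right scaleR_add_left)

end

section \<open>Polynomials\<close>

text \<open>The variables are indexed by a finite type \<open>'n\<close>. A polynomial maps exponent vectors to
  coefficients; its product is the convolution product of \<open>Poly_Mapping\<close>.\<close>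

type_synonym 'n rpoly = "('n \<Rightarrow>\<^sub>0 nat) \<Rightarrow>\<^sub>0 real"

definition pvar :: "'n \<Rightarrow> 'n rpoly" where
  "pvar i = Poly_Mapping.single (Poly_Mapping.single i 1) 1"

definition monomials :: "'n rpoly set" where
  "monomials = {Poly_Mapping.single \<alpha> 1 | \<alpha>. True}"

definition peval :: "'n::finite rpoly \<Rightarrow> real ^ 'n \<Rightarrow> real" where
  "peval p x =
     (\<Sum>\<alpha>\<in>Poly_Mapping.keys p.
        Poly_Mapping.lookup p \<alpha> * (\<Prod>i\<in>UNIV. (x $ i) ^ Poly_Mapping.lookup \<alpha> i))"

definition connected_to_1 :: "'n rpoly set \<Rightarrow> bool" where
  "connected_to_1 B \<longleftrightarrow>
     B \<subseteq> monomials \<and> 1 \<in> B \<and> (\<forall>m\<in>B. m \<noteq> 1 \<longrightarrow> (\<exists>i. \<exists>m'\<in>B. m = pvar i * m'))"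

definition plus_set :: "'n rpoly set \<Rightarrow> 'n rpoly set" where
  "plus_set B = B \<union> (\<Union>i. (\<lambda>m. pvar i * m) ` B)"

definition products :: "'n rpoly set \<Rightarrow> 'n rpoly set" where
  "products S = {p * q | p q. p \<in> S \<and> q \<in> S}"

lemma module_times: "module ((*) :: 'a::comm_ring_1 \<Rightarrow> 'a \<Rightarrow> 'a)"
  by unfold_locales (simp_all add: algebra_simps)

text \<open>Ideals are the submodules of the ring over itself (see \<open>module_times\<close>).\<close>

definition ideal_gen :: "'n rpoly set \<Rightarrow> 'n rpoly set" where
  "ideal_gen S = module.span (*) S"

text \<open>For \<open>f\<close> that attains its minimum, this infimum is that minimum.\<close>

definition min_value :: "'n::finite rpoly \<Rightarrow> real" where
  "min_value f = (INF x. peval f x)"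

definition I_min :: "'n::finite rpoly \<Rightarrow> 'n rpoly set" where
  "I_min f = {p. \<forall>x. peval f x = min_value f \<longrightarrow> peval p x = 0}"

section \<open>Linear forms and truncated Hankel operators\<close>

text \<open>A linear form on a subspace \<open>V\<close> is represented by its extension by \<open>0\<close> outside \<open>V\<close>,
  so that each element of the dual space has exactly one representative and the vector space
  operations of the dual are the pointwise ones.\<close>

definition dual :: "'n rpoly set \<Rightarrow> ('n rpoly \<Rightarrow> real) set" where
  "dual V = {\<Lambda>. (\<forall>p\<in>V. \<forall>q\<in>V. \<Lambda> (p + q) = \<Lambda> p + \<Lambda> q) \<and>
                 (\<forall>c. \<forall>p\<in>V. \<Lambda> (c *\<^sub>R p) = c * \<Lambda> p) \<and>
                 (\<forall>p. p \<notin> V \<longrightarrow> \<Lambda> p = 0)}"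

definition hankel ::
  "'n rpoly set \<Rightarrow> ('n rpoly \<Rightarrow> real) \<Rightarrow> 'n rpoly \<Rightarrow> 'n rpoly \<Rightarrow> real" where
  "hankel V \<Lambda> p = (\<lambda>q. if q \<in> V then \<Lambda> (p * q) else 0)"

definition hankel_rank :: "'n rpoly set \<Rightarrow> ('n rpoly \<Rightarrow> real) \<Rightarrow> nat" where
  "hankel_rank V \<Lambda> = dim (hankel V \<Lambda> ` V)"

definition hankel_ker :: "'n rpoly set \<Rightarrow> ('n rpoly \<Rightarrow> real) \<Rightarrow> 'n rpoly set" where
  "hankel_ker V \<Lambda> = {p \<in> V. \<forall>q\<in>V. \<Lambda> (p * q) = 0}"

section \<open>The moment and the sum-of-squares relaxation\<close>

definition psd_forms :: "'n rpoly set \<Rightarrow> 'n rpoly set \<Rightarrow> ('n rpoly \<Rightarrow> real) set" where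
  "psd_forms G E = {\<Lambda> \<in> dual (span (products E)).
     (\<forall>g\<in>G. \<Lambda> g = 0) \<and> \<Lambda> 1 = 1 \<and> (\<forall>p\<in>E. \<Lambda> (p ^ 2) \<ge> 0)}"

text \<open>The summand in \<open>G\<close> is a single element, so this is a convex cone only if \<open>G\<close> is closed under
  addition and nonnegative scaling. For an arbitrary set \<open>G\<close> of polynomials, use it with
  \<open>span G\<close> (\<open>psd_forms\<close> does not distinguish \<open>G\<close> from \<open>span G\<close> when \<open>G \<subseteq> span (products E)\<close>).\<close>

definition sos_set :: "'n rpoly set \<Rightarrow> 'n rpoly set \<Rightarrow> 'n rpoly set" where
  "sos_set G E = {p. \<exists>(s::nat) h g. (\<forall>i\<in>{1..s}. h i \<in> E) \<and> g \<in> G \<and>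
     p = (\<Sum>i=1..s. (h i) ^ 2) + g}"

definition f_mu :: "'n rpoly set \<Rightarrow> 'n rpoly set \<Rightarrow> 'n rpoly \<Rightarrow> ereal" where
  "f_mu G E f = (INF \<Lambda>\<in>psd_forms G E. ereal (\<Lambda> f))"

definition f_sos :: "'n rpoly set \<Rightarrow> 'n rpoly set \<Rightarrow> 'n rpoly \<Rightarrow> ereal" where
  "f_sos G E f = Sup {ereal c | c. f - Poly_Mapping.single 0 c \<in> sos_set G E}"

definition generic_for ::
  "'n rpoly set \<Rightarrow> 'n rpoly set \<Rightarrow> 'n rpoly \<Rightarrow> ('n rpoly \<Rightarrow> real) \<Rightarrow> bool" where
  "generic_for G E f \<Lambda> \<longleftrightarrow>
     \<Lambda> \<in> psd_forms G E \<and> ereal (\<Lambda> f) = f_mu G E f \<and>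
     (\<forall>\<Lambda>'\<in>psd_forms G E. ereal (\<Lambda>' f) = f_mu G E f \<longrightarrow> hankel_rank E \<Lambda>' \<le> hankel_rank E \<Lambda>)"

end

theory Submission
  imports Defs "HOL-Computational_Algebra.Fundamental_Theorem_Algebra"
begin

text \<open>Write \<open>A\<close> for the span of \<open>B\<close>, \<open>E\<close> for the span of \<open>plus_set B\<close>, and \<open>K\<close> for the kernel of the Hankel
  operator of the generic form \<open>\<Lambda>\<close> on \<open>E\<close>.

  The rank condition means that \<open>\<Lambda> (p * q)\<close> is an inner product on \<open>A\<close> and that \<open>E\<close> is the direct sum of \<open>A\<close>
  and \<open>K\<close>. Multiplying an element of \<open>A\<close> by a variable and projecting back to \<open>A\<close> along \<open>K\<close> gives
  operators that are symmetric and commute. They have a joint orthogonal eigenbasis, and the eigenvalue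
  tuples are real points. This turns \<open>\<Lambda>\<close> into a positive combination of evaluations at finitely many
  points, and shows that every polynomial that vanishes at these points lies in the ideal of \<open>K\<close>
  (lemma \<open>atomic_representation\<close>, based on the spectral theorem \<open>span_joint_eigenvectors\<close>).

  So \<open>\<Lambda> f\<close> is an average of values of \<open>f\<close> and is at least the minimum. Evaluation at a minimizer is
  feasible for the moment relaxation because \<open>G\<close> vanishes there. Hence \<open>\<Lambda> f\<close> is the minimum and all
  atoms are minimizers, so \<open>I_min f\<close> is contained in the ideal of \<open>K\<close>. For the converse, averaging \<open>\<Lambda>\<close>
  with the evaluation at a minimizer gives an optimal form whose kernel is contained in \<open>K\<close>; by maximality
  of the rank it is \<open>K\<close>, so \<open>K\<close> vanishes at the minimizer (lemma \<open>K_in_kernel\<close>).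

  For the sums of squares, a gap would come from a nonzero form \<open>M\<close> in the dual cone with \<open>M 1 = 0\<close> and
  \<open>M f \<le> 0\<close>, that is, from an unbounded direction in the set of optimal forms. The same genericity argument
  shows that \<open>M\<close> vanishes on \<open>K\<close> times \<open>E\<close>, and with \<open>M 1 = 0\<close> and the connectedness of \<open>B\<close> it vanishes on all
  products of elements of \<open>E\<close> (lemma \<open>recession_trivial\<close>). As no such direction exists, for every \<open>c\<close>
  below the minimum a separation argument makes \<open>f - c\<close> a sum of squares modulo \<open>span G\<close> (lemma
  \<open>sos_below_min\<close>). The supremum defining \<open>f_sos\<close> is thus the minimum, whether or not it is attained.\<close>

section \<open>Separation from a convex cone with an order unit\<close>

text \<open>M. Riesz' extension argument. When the form \<open>L\<close> is extended from \<open>M\<close> to \<open>M + \<real> v\<close>, its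
  value at \<open>v\<close> must be at least \<open>L m\<close> whenever \<open>v - m \<in> D\<close> and at most \<open>L m'\<close> whenever
  \<open>m' - v \<in> D\<close>. Adding such memberships gives \<open>m' - m \<in> D\<close>, so that the lower bounds never exceed
  the upper ones; the order unit \<open>e\<close> provides bounds of both kinds.\<close>

lemma nonneg_linear_form_extension:
  fixes D :: "'a::real_vector set" and e :: 'a
  assumes "finite S" and e: "-e \<notin> D" and "0 \<in> D"
    and add: "\<And>x y. x \<in> D \<Longrightarrow> y \<in> D \<Longrightarrow> x + y \<in> D"
    and scale: "\<And>c x. 0 \<le> c \<Longrightarrow> x \<in> D \<Longrightarrow> c *\<^sub>R x \<in> D"
    and unit: "\<And>v. v \<in> S \<Longrightarrow> \<exists>t. t *\<^sub>R e + v \<in> D \<and> t *\<^sub>R e - v \<in> D"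
  shows "\<exists>L::'a \<Rightarrow> real. linear L \<and> L e = 1 \<and> (\<forall>d\<in>D \<inter> span (insert e S). 0 \<le> L d)"
  using \<open>finite S\<close> unit
proof (induction S)
  case empty
  have "e \<noteq> 0" using e \<open>0 \<in> D\<close> by auto
  then obtain L :: "'a \<Rightarrow> real" where L: "linear L" "L e = 1"
    using linear_independent_extend[of "{e}" "\<lambda>_. 1::real"] by auto
  have "0 \<le> L d" if "d \<in> D" "d \<in> span {e}" for d
  proof -
    obtain t where t: "d = t *\<^sub>R e" using \<open>d \<in> span {e}\<close> by (auto simp: span_singleton)
    have "t \<ge> 0"
    proof (rule ccontr)
      assume "\<not> t \<ge> 0"
      then have "(1 / (-t)) *\<^sub>R d \<in> D" using scale[of "1 / (-t)" d] that by simp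
      then show False using e t \<open>\<not> t \<ge> 0\<close> by simp
    qed
    then show ?thesis using t L by (simp add: linear_scale)
  qed
  then show ?case using L by auto
next
  case (insert v S)
  define M where "M = span (insert e S)"
  obtain L :: "'a \<Rightarrow> real" where L: "linear L" "L e = 1" and Lpos: "\<And>d. d \<in> D \<Longrightarrow> d \<in> M \<Longrightarrow> 0 \<le> L d"
    using insert.IH insert.prems unfolding M_def by blast
  have M: "subspace M" "e \<in> M" by (auto simp: M_def span_base)
  show ?case
  proof (cases "v \<in> M")
    case True
    then have "span (insert e (insert v S)) = M"
      by (metis M_def insert_commute span_redundant)
    then show ?thesis using L Lpos by auto
  next
    case False
    \<comment> \<open>\<open>\<delta>\<close> is the coordinate along \<open>v\<close>; adding a multiple of it changes \<open>L\<close> only outside \<open>M\<close>.\<close>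
    obtain \<delta> :: "'a \<Rightarrow> real" where \<delta>: "linear \<delta>" "\<And>m. m \<in> M \<Longrightarrow> \<delta> m = 0" "\<delta> v = 1"
    proof -
      obtain I where I: "I \<subseteq> M" "independent I" "M \<subseteq> span I"
        using maximal_independent_subset by blast
      have "span I = M" using I M by (simp add: span_subspace)
      then have "independent (insert v I)" using False I by (simp add: independent_insert)
      then obtain \<delta> :: "'a \<Rightarrow> real" where d: "linear \<delta>" "\<forall>x\<in>insert v I. \<delta> x = (if x = v then 1 else 0)"
        using linear_independent_extend[of "insert v I" "\<lambda>x. if x = v then 1 else 0::real"] by blast
      have "\<delta> m = 0" if "m \<in> M" for m
        using linear_eq_0_on_span[of \<delta> I m] d False I \<open>m \<in> M\<close> by force
      then show ?thesis using that d by auto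
    qed
    define X where "X = {L m | m. m \<in> M \<and> v - m \<in> D}"
    define a where "a = Sup X"
    obtain t where t: "t *\<^sub>R e + v \<in> D" "t *\<^sub>R e - v \<in> D" using insert.prems by blast
    have bound: "L m \<le> L m'" if "m \<in> M" "v - m \<in> D" "m' \<in> M" "m' - v \<in> D" for m m'
    proof -
      have "m' - m \<in> D" using add[OF that(4,2)] by simp
      then have "0 \<le> L (m' - m)" using Lpos that M by (simp add: subspace_diff)
      then show ?thesis using L by (simp add: linear_diff)
    qed
    have te: "t *\<^sub>R e \<in> M" "- (t *\<^sub>R e) \<in> M" using M by (simp_all add: subspace_scale subspace_neg)
    have "X \<noteq> {}"
      using t(1) te by (auto simp: X_def intro!: exI[of _ "- (t *\<^sub>R e)"] simp: add.commute)
    have bdd: "bdd_above X"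
      using bound[OF _ _ te(1) t(2)] by (auto simp: X_def bdd_above_def)
    have lower: "L m \<le> a" if "m \<in> M" "v - m \<in> D" for m
      unfolding a_def using that bdd by (intro cSup_upper) (auto simp: X_def)
    have upper: "a \<le> L m'" if "m' \<in> M" "m' - v \<in> D" for m'
      unfolding a_def using \<open>X \<noteq> {}\<close> bound that by (intro cSup_least) (auto simp: X_def)
    define L' where "L' x = L x + (a - L v) * \<delta> x" for x
    have L': "linear L'"
      unfolding L'_def using L(1) \<delta>(1)
      by (auto intro!: linearI simp: linear_add linear_scale algebra_simps)
    have L'M: "L' m = L m" if "m \<in> M" for m using that \<delta> by (simp add: L'_def)
    have L'v: "L' v = a" using \<delta> by (simp add: L'_def)
    have "0 \<le> L' d" if d: "d \<in> D" and ds: "d \<in> span (insert e (insert v S))" for d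
    proof -
      obtain s where s: "d - s *\<^sub>R v \<in> M"
        using ds unfolding M_def by (metis insert_commute span_breakdown_eq)
      define m where "m = d - s *\<^sub>R v"
      have m: "m \<in> M" "d = m + s *\<^sub>R v" using s by (simp_all add: m_def)
      have L'd: "L' d = L m + s * a"
        using m L' L'M L'v by (simp add: linear_add linear_scale)
      have mem: "(1 / \<bar>s\<bar>) *\<^sub>R d \<in> D" using scale d by simp
      consider "s = 0" | "s > 0" | "s < 0" by linarith
      then show ?thesis
      proof cases
        case 1 then show ?thesis using L'd m d Lpos by simp
      next
        case 2
        have "L (- ((1/s) *\<^sub>R m)) \<le> a"
          using mem 2 m M
          by (intro lower) (auto simp: subspace_neg subspace_scale scaleR_add_right add.commute)
        then show ?thesis using 2 L L'd by (simp add: linear_neg linear_scale field_simps)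
      next
        case 3
        have "a \<le> L ((1/(-s)) *\<^sub>R m)"
          using mem 3 m M
          by (intro upper) (auto simp: subspace_neg subspace_scale scaleR_add_right)
        then show ?thesis using 3 L L'd by (simp add: linear_neg linear_scale field_simps)
      qed
    qed
    then show ?thesis using L' L'M L M by (intro exI[of _ L']) auto
  qed
qed

text \<open>The cone \<open>D\<close> generated by \<open>C\<close> and \<open>-z\<close> does not contain \<open>-e\<close>: otherwise \<open>t *\<^sub>R z \<in> e + C\<close> for some
  \<open>t \<ge> 0\<close>, which puts \<open>z\<close> into \<open>C\<close> if \<open>t > 0\<close>, and which gives \<open>-e \<in> C\<close>, hence \<open>span S \<subseteq> C\<close>, if
  \<open>t = 0\<close>. So there is a form that is nonnegative on \<open>D\<close>. The normalization \<open>L e = 1\<close> records that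
  this form does not vanish on \<open>span S\<close>, which is what a proper separation has to guarantee.\<close>

lemma cone_separation:
  fixes C :: "'a::real_vector set" and e z :: 'a
  assumes "finite S" and "e \<in> C" and "0 \<in> C"
    and add: "\<And>x y. x \<in> C \<Longrightarrow> y \<in> C \<Longrightarrow> x + y \<in> C"
    and scale: "\<And>c x. 0 \<le> c \<Longrightarrow> x \<in> C \<Longrightarrow> c *\<^sub>R x \<in> C"
    and unit: "\<And>v. v \<in> span S \<Longrightarrow> \<exists>t. t *\<^sub>R e + v \<in> C"
    and z: "z \<in> span S" "z \<notin> C"
  obtains L :: "'a \<Rightarrow> real" where "linear L" "L e = 1" "\<And>c. c \<in> C \<Longrightarrow> c \<in> span S \<Longrightarrow> 0 \<le> L c" "L z \<le> 0"
proof -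
  define D where "D = {c - t *\<^sub>R z | c t. c \<in> C \<and> 0 \<le> t}"
  have CD: "c \<in> D" if "c \<in> C" for c
    unfolding D_def using that by (intro CollectI exI[of _ c] exI[of _ "0::real"]) simp
  have D_add: "x + y \<in> D" if x: "x \<in> D" and y: "y \<in> D" for x y
  proof -
    obtain c t c' t' where "c \<in> C" "0 \<le> t" "x = c - t *\<^sub>R z" "c' \<in> C" "0 \<le> t'" "y = c' - t' *\<^sub>R z"
      using x y unfolding D_def by blast
    then have "x + y = (c + c') - (t + t') *\<^sub>R z" "c + c' \<in> C" "0 \<le> t + t'"
      using add by (auto simp: algebra_simps)
    then show ?thesis unfolding D_def by blast
  qed
  have D_scale: "s *\<^sub>R x \<in> D" if s: "0 \<le> s" and x: "x \<in> D" for s x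
  proof -
    obtain c t where "c \<in> C" "0 \<le> t" "x = c - t *\<^sub>R z" using x by (auto simp: D_def)
    then have "s *\<^sub>R x = s *\<^sub>R c - (s * t) *\<^sub>R z" "s *\<^sub>R c \<in> C" "0 \<le> s * t"
      using scale s by (auto simp: algebra_simps)
    then show ?thesis unfolding D_def by blast
  qed
  have "- e \<notin> D"
  proof
    assume "- e \<in> D"
    then obtain c t where c: "c \<in> C" "0 \<le> t" "- e = c - t *\<^sub>R z" by (auto simp: D_def)
    then have tz: "t *\<^sub>R z = c + e" by (simp add: algebra_simps eq_neg_iff_add_eq_0)
    then have ce: "t *\<^sub>R z \<in> C" using add c \<open>e \<in> C\<close> by simp
    show False
    proof (cases "t = 0")
      case True
      obtain s where s: "s *\<^sub>R e + z \<in> C" using unit z by blast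
      have "- e \<in> C" using True tz c by (simp add: eq_neg_iff_add_eq_0)
      moreover have "- s *\<^sub>R e = \<bar>s\<bar> *\<^sub>R (- e) \<or> - s *\<^sub>R e = \<bar>s\<bar> *\<^sub>R e" by (simp add: abs_if)
      ultimately have "- s *\<^sub>R e \<in> C" using scale[of "\<bar>s\<bar>"] \<open>e \<in> C\<close> by (metis abs_ge_zero)
      from add[OF s this] show False using z by simp
    next
      case False
      have "0 \<le> 1/t" using c(2) by simp
      from scale[OF this ce] have "(1/t) *\<^sub>R (t *\<^sub>R z) \<in> C" .
      moreover have "(1/t) *\<^sub>R (t *\<^sub>R z) = z" using False by simp
      ultimately show False using z by metis
    qed
  qed
  moreover have "\<exists>t. t *\<^sub>R e + v \<in> D \<and> t *\<^sub>R e - v \<in> D" if "v \<in> S" for v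
  proof -
    obtain t t' where tt: "t *\<^sub>R e + v \<in> C" "t' *\<^sub>R e - v \<in> C"
      using unit[of v] unit[of "- v"] \<open>v \<in> S\<close> by (auto simp: span_base span_neg)
    have "s *\<^sub>R e + u \<in> C" if "r *\<^sub>R e + u \<in> C" "r \<le> s" for r s u
      using add[OF that(1) scale[of "s - r" e]] \<open>e \<in> C\<close> that(2) by (simp add: algebra_simps)
    from this[OF tt(1), of "max t t'"] this[of t' "-v" "max t t'"] tt(2)
    show ?thesis by (intro exI[of _ "max t t'"]) (auto intro: CD)
  qed
  ultimately obtain L :: "'a \<Rightarrow> real" where L: "linear L" "L e = 1"
    and pos: "\<forall>d\<in>D \<inter> span (insert e S). 0 \<le> L d"
    using nonneg_linear_form_extension[of S e D] \<open>finite S\<close> D_add D_scale CD[OF \<open>0 \<in> C\<close>] by blast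
  have sub: "span S \<subseteq> span (insert e S)" by (simp add: span_mono subset_insertI)
  have "- z \<in> D"
    unfolding D_def using \<open>0 \<in> C\<close> by (intro CollectI exI[of _ "0::'a"] exI[of _ "1::real"]) simp
  then have "0 \<le> L (- z)" using pos sub z(1) by (auto simp: span_neg)
  then have "L z \<le> 0" using L by (simp add: linear_neg)
  then show ?thesis using that[of L] L pos sub CD by auto
qed

section \<open>Commuting symmetric operators\<close>

text \<open>The vector \<open>p(T) v\<close>, computed by Horner's scheme.\<close>

definition poly_op :: "('a \<Rightarrow> 'a) \<Rightarrow> real poly \<Rightarrow> 'a \<Rightarrow> 'a::real_vector" where
  "poly_op T p v = fold_coeffs (\<lambda>a w. a *\<^sub>R v + T w) p 0"

lemma poly_op_0 [simp]: "poly_op T 0 v = 0"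
  by (simp add: poly_op_def)

context
  fixes T :: "'a::real_vector \<Rightarrow> 'a"
  assumes T: "linear T"
begin

lemma poly_op_pCons [simp]: "poly_op T (pCons a p) v = a *\<^sub>R v + T (poly_op T p v)"
  by (cases "a = 0 \<and> p = 0") (auto simp: poly_op_def linear_0[OF T])

lemma poly_op_add: "poly_op T (p + q) v = poly_op T p v + poly_op T q v"
proof (induction p arbitrary: q)
  case (pCons a p)
  obtain b r where "q = pCons b r" by (cases q)
  then show ?case by (simp add: pCons.IH linear_add[OF T] algebra_simps)
qed simp

lemma poly_op_smult: "poly_op T (smult c p) v = c *\<^sub>R poly_op T p v"
  by (induction p) (simp_all add: linear_scale[OF T] algebra_simps)

lemma poly_op_mult: "poly_op T (p * q) v = poly_op T p (poly_op T q v)"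
  by (induction p) (simp_all add: poly_op_add poly_op_smult)

lemma poly_op_monom: "poly_op T (monom 1 n) v = (T ^^ n) v"
  by (induction n) (simp_all add: monom_0 monom_Suc linear_0[OF T])

lemma poly_op_in_subspace:
  assumes "subspace U" "\<And>u. u \<in> U \<Longrightarrow> T u \<in> U" "v \<in> U"
  shows "poly_op T p v \<in> U"
  using assms by (induction p) (simp_all add: subspace_0 subspace_add subspace_scale)

lemma poly_op_diff_vector: "poly_op T p (v - w) = poly_op T p v - poly_op T p w"
  by (induction p) (simp_all add: linear_diff[OF T] scaleR_diff_right)

lemma poly_op_scale_vector: "poly_op T p (c *\<^sub>R v) = c *\<^sub>R poly_op T p v"
  by (induction p) (simp_all add: linear_scale[OF T] scaleR_add_right mult.commute)

lemma poly_op_commute: "poly_op T p (T v) = T (poly_op T p v)"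
  by (induction p) (simp_all add: linear_0[OF T] linear_add[OF T] linear_scale[OF T])

lemma poly_op_eigenvector:
  assumes "T v = c *\<^sub>R v"
  shows "poly_op T p v = poly p c *\<^sub>R v"
  by (induction p) (simp_all add: linear_scale[OF T] assms algebra_simps)

text \<open>In a finite-dimensional space the vectors \<open>v\<close>, \<open>T v\<close>, \<open>T (T v)\<close>, and so on are not all independent of
  their predecessors; the first dependence is a monic polynomial relation.\<close>

lemma annihilating_poly_exists:
  assumes "finite S" and orbit: "\<And>n. (T ^^ n) v \<in> span S"
  shows "\<exists>p. p \<noteq> 0 \<and> poly_op T p v = 0"
proof -
  let ?W = "\<lambda>k. (\<lambda>i. (T ^^ i) v) ` {..<k}"
  have "\<exists>k. (T ^^ k) v \<in> span (?W k)"
  proof (rule ccontr)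
    assume no: "\<nexists>k. (T ^^ k) v \<in> span (?W k)"
    have "independent (?W k) \<and> card (?W k) = k" for k
    proof (induction k)
      case (Suc k)
      have "?W (Suc k) = insert ((T ^^ k) v) (?W k)" by (auto simp: lessThan_Suc)
      moreover have "(T ^^ k) v \<notin> ?W k" using no span_base by metis
      ultimately show ?case using Suc no by (simp add: independent_insert)
    qed (simp add: independent_empty)
    moreover have "?W k \<subseteq> span S" for k using orbit by auto
    ultimately have "Suc (card S) \<le> card S"
      using independent_span_bound[OF \<open>finite S\<close>] by metis
    then show False by simp
  qed
  then obtain k where k: "(T ^^ k) v \<in> span (?W k)" ..
  have "\<exists>p. (\<forall>i\<ge>k. coeff p i = 0) \<and> x = poly_op T p v" if "x \<in> span (?W k)" for x
    using that
  proof (induction rule: span_induct_alt)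
    case base
    then show ?case by (intro exI[of _ 0]) simp
  next
    case (step c x y)
    then obtain i p where i: "i < k" "x = (T ^^ i) v" and p: "\<forall>i\<ge>k. coeff p i = 0" "y = poly_op T p v"
      by auto
    then show ?case
      by (intro exI[of _ "smult c (monom 1 i) + p"])
        (auto simp: poly_op_add poly_op_smult poly_op_monom)
  qed
  then obtain p where p: "\<forall>i\<ge>k. coeff p i = 0" "(T ^^ k) v = poly_op T p v" using k by blast
  have "coeff (monom 1 k + smult (-1) p) k = 1" using p by simp
  then have "monom 1 k + smult (-1) p \<noteq> 0" by (metis coeff_0 zero_neq_one)
  moreover have "poly_op T (monom 1 k + smult (-1) p) v = 0"
    by (simp only: poly_op_add poly_op_smult poly_op_monom p) simp
  ultimately show ?thesis by blast
qed

end

text \<open>Take a complex root \<open>z\<close>. If it is not real, then the remainder of \<open>p\<close> modulo the real quadratic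
  with roots \<open>z\<close> and its conjugate has degree at most 1, real coefficients and the root \<open>z\<close>, and is
  therefore 0.\<close>

lemma real_poly_factor:
  fixes p :: "real poly"
  assumes "0 < degree p"
  obtains (linear) c q where "p = [:- c, 1:] * q"
  | (quadratic) a b q where "b \<noteq> 0" "p = [:a\<^sup>2 + b\<^sup>2, - 2 * a, 1:] * q"
proof -
  let ?C = "map_poly complex_of_real"
  have C_pCons: "?C (pCons a q) = pCons (of_real a) (?C q)" for a q
    by (simp add: map_poly_pCons)
  have C_add: "poly (?C (q + r)) z = poly (?C q) z + poly (?C r) z" for q r z
  proof (induction q arbitrary: r)
    case (pCons a q) then show ?case by (cases r) (simp add: C_pCons algebra_simps)
  qed simp
  have C_smult: "poly (?C (smult a q)) z = of_real a * poly (?C q) z" for a q z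
    by (induction q) (simp_all add: C_pCons algebra_simps)
  have C_mult: "poly (?C (q * r)) z = poly (?C q) z * poly (?C r) z" for q r z
    by (induction q) (simp_all add: C_pCons C_add C_smult algebra_simps)
  have "degree (?C p) = degree p" by (simp add: degree_map_poly)
  then have "\<not> constant (poly (?C p))" using assms by (simp add: constant_degree)
  then obtain z where z: "poly (?C p) z = 0" using fundamental_theorem_of_algebra by blast
  define a b where "a = Re z" and "b = Im z"
  have zab: "z = Complex a b" by (simp add: a_def b_def)
  show thesis
  proof (cases "b = 0")
    case True
    then have "z = of_real a" by (simp add: zab complex_eq_iff)
    moreover have "poly (?C q) (of_real a) = of_real (poly q a)" for q
      by (induction q) (simp_all add: C_pCons)
    ultimately have "poly p a = 0" using z by simp
    then show thesis using linear by (metis dvdE poly_eq_0_iff_dvd)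
  next
    case False
    let ?m = "[:a\<^sup>2 + b\<^sup>2, - 2 * a, 1:]"
    define r where "r = p mod ?m"
    have "degree r < degree ?m \<or> r = 0" unfolding r_def using degree_mod_less[of ?m p] by auto
    then have "degree r \<le> 1" by auto
    moreover obtain r0 s where s: "r = pCons r0 s" by (cases r)
    ultimately have "degree s = 0" by (auto split: if_splits)
    then obtain r1 where r: "r = [:r0, r1:]" using s by (metis degree_eq_zeroE)
    have "poly (?C ?m) z = 0"
      by (simp add: C_pCons zab complex_eq_iff power2_eq_square algebra_simps)
    moreover have p: "p = ?m * (p div ?m) + r" unfolding r_def by (rule mult_div_mod_eq [symmetric])
    moreover have "poly (?C p) z = poly (?C ?m) z * poly (?C (p div ?m)) z + poly (?C r) z"
      by (subst p) (simp only: C_add C_mult)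
    ultimately have "poly (?C r) z = 0" using z by simp
    then have "r1 * b = 0" "r0 + a * r1 = 0"
      by (simp_all add: r C_pCons zab complex_eq_iff algebra_simps)
    then have "r1 = 0" "r0 = 0" using False by auto
    then have "r = 0" using r by simp
    then have "p = ?m * (p div ?m)" using p by (simp only: add_0_right)
    then show thesis by (rule quadratic[OF False])
  qed
qed

text \<open>An inner product on the subspace \<open>U\<close>. Only positivity is relative to \<open>U\<close>; bilinearity is total, which
  keeps membership conditions out of the calculations.\<close>

locale positive_definite_form =
  fixes U :: "'a::real_vector set" and ip :: "'a \<Rightarrow> 'a \<Rightarrow> real"
  assumes U: "subspace U"
    and bilin: "bilinear ip"
    and comm: "ip x y = ip y x"
    and pos: "x \<in> U \<Longrightarrow> x \<noteq> 0 \<Longrightarrow> 0 < ip x x"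
begin

lemma definite: "x \<in> U \<Longrightarrow> ip x x \<le> 0 \<Longrightarrow> x = 0"
  using pos by fastforce

lemma positive_definite_form_subspace:
  "subspace U' \<Longrightarrow> U' \<subseteq> U \<Longrightarrow> positive_definite_form U' ip"
  using bilin comm pos by unfold_locales auto

text \<open>The spectral theorem for one symmetric operator. The proof descends along the degree of a
  polynomial \<open>p\<close> with \<open>p(T) v = 0\<close>. A quadratic factor \<open>(T - a)\<^sup>2 + b\<^sup>2\<close> with \<open>b \<noteq> 0\<close> is injective on \<open>U\<close>
  and can be cancelled. If \<open>p = (X - c) q\<close>, then \<open>u = q(T) v\<close> is an eigenvector or 0, and \<open>q(T)\<close>
  annihilates the part of \<open>v\<close> that is orthogonal to \<open>u\<close>: by symmetry \<open>q(c)\<close> times the inner product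
  of \<open>v\<close> and \<open>u\<close> is the inner product of \<open>u\<close> with itself.\<close>

lemma span_eigenvectors_symmetric:
  assumes T: "linear T" and inv: "\<And>u. u \<in> U \<Longrightarrow> T u \<in> U"
    and sym: "\<And>u v. u \<in> U \<Longrightarrow> v \<in> U \<Longrightarrow> ip (T u) v = ip u (T v)"
    and fin: "finite S" "U \<subseteq> span S"
    and v: "v \<in> U"
  shows "v \<in> span {u \<in> U. \<exists>c. T u = c *\<^sub>R u}" (is "_ \<in> span ?Eig")
proof -
  note bil = bilinear_ladd[OF bilin] bilinear_radd[OF bilin] bilinear_lmul[OF bilin]
    bilinear_rmul[OF bilin] bilinear_lsub[OF bilin] bilinear_rsub[OF bilin]
    bilinear_lneg[OF bilin] bilinear_rneg[OF bilin]
    bilinear_lzero[OF bilin] bilinear_rzero[OF bilin]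
  note opU = poly_op_in_subspace[OF T U inv]
  have sym_op: "ip (poly_op T p u) w = ip u (poly_op T p w)" if "u \<in> U" "w \<in> U" for p u w
    using that
  proof (induction p arbitrary: u w)
    case (pCons a p)
    have "ip (T (poly_op T p u)) w = ip (poly_op T p u) (T w)" using sym opU pCons.prems by simp
    also have "\<dots> = ip u (T (poly_op T p w))"
      using pCons inv by (simp add: poly_op_commute[OF T])
    finally show ?case by (simp add: poly_op_pCons[OF T] bil)
  qed (simp add: bil)
  have "v \<in> span ?Eig" if "p \<noteq> 0" "poly_op T p v = 0" "v \<in> U" for p v
    using that
  proof (induction "degree p" arbitrary: p v rule: less_induct)
    case less
    show ?case
    proof (cases "degree p = 0")
      case True
      then obtain c where "p = [:c:]" by (meson degree_eq_zeroE)
      then have "v = 0" using less.prems by (simp add: poly_op_pCons[OF T] linear_0[OF T])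
      then show ?thesis by (simp add: span_zero)
    next
      case False
      then have "0 < degree p" by simp
      then show ?thesis
      proof (cases rule: real_poly_factor)
        case (linear c q)
        define u where "u = poly_op T q v"
        have q: "q \<noteq> 0" using less.prems(1) unfolding linear by (metis mult_zero_right)
        have deg: "degree q < degree p"
          using degree_mult_eq[of "[:- c, 1:]" q] q unfolding linear by simp
        have uU: "u \<in> U" using opU less.prems by (simp add: u_def)
        have "poly_op T [:- c, 1:] u = 0"
          using less.prems linear(1) by (simp only: u_def poly_op_mult[OF T])
        then have Tu: "T u = c *\<^sub>R u"
          by (simp add: poly_op_pCons[OF T] linear_0[OF T] algebra_simps)
        show ?thesis
        proof (cases "u = 0")
          case True
          then show ?thesis using less.hyps[OF deg q] less.prems by (simp add: u_def)
        next
          case False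
          \<comment> \<open>\<open>k *\<^sub>R u\<close> is the orthogonal projection of \<open>v\<close> onto the eigenvector \<open>u\<close>.\<close>
          define k where "k = ip v u / ip u u"
          have uu: "ip u u > 0" using pos uU False by simp
          have "ip v u * poly q c = ip v (poly_op T q u)"
            using poly_op_eigenvector[OF T Tu] by (simp add: bil)
          also have "\<dots> = ip u u" using sym_op less.prems uU by (simp add: u_def)
          finally have "k * poly q c = 1" using uu by (simp add: k_def field_simps)
          then have "poly_op T q (v - k *\<^sub>R u) = 0"
            using poly_op_eigenvector[OF T Tu]
            by (simp add: poly_op_diff_vector[OF T] poly_op_scale_vector[OF T] flip: u_def)
          moreover have "v - k *\<^sub>R u \<in> U" using less.prems uU U by (simp add: subspace_diff subspace_scale)
          ultimately have "v - k *\<^sub>R u \<in> span ?Eig" using less.hyps[OF deg q] by blast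
          moreover have "k *\<^sub>R u \<in> span ?Eig" using uU Tu by (intro span_scale span_base) auto
          ultimately show ?thesis using span_add[of "v - k *\<^sub>R u" ?Eig "k *\<^sub>R u"] by simp
        qed
      next
        case (quadratic a b q)
        define u where "u = poly_op T q v"
        have q: "q \<noteq> 0" using less.prems(1) unfolding quadratic(2) by (metis mult_zero_right)
        have deg: "degree q < degree p"
          using degree_mult_eq[of "[:a\<^sup>2 + b\<^sup>2, - 2 * a, 1:]" q] q unfolding quadratic(2) by simp
        have uU: "u \<in> U" using opU less.prems by (simp add: u_def)
        have "poly_op T [:a\<^sup>2 + b\<^sup>2, - 2 * a, 1:] u = 0"
          using less.prems quadratic by (simp only: u_def poly_op_mult[OF T])
        then have TTu: "(a\<^sup>2 + b\<^sup>2) *\<^sub>R u + T (- (2 * a) *\<^sub>R u + T u) = 0"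
          by (simp add: poly_op_pCons[OF T] linear_0[OF T])
        define w where "w = T u - a *\<^sub>R u"
        have wU: "w \<in> U" using uU inv U by (simp add: w_def subspace_diff subspace_scale)
        have "(a * 2) *\<^sub>R T u = a *\<^sub>R T u + a *\<^sub>R T u" by (simp flip: scaleR_add_left)
        then have Tw: "T w - a *\<^sub>R w = - (b\<^sup>2 *\<^sub>R u)"
          using TTu by (simp add: w_def linear_diff[OF T] linear_add[OF T] linear_scale[OF T] linear_neg[OF T]
              algebra_simps power2_eq_square eq_neg_iff_add_eq_0)
        \<comment> \<open>Symmetry moves \<open>T - a\<close> across the form, so that \<open>ip w w\<close> is both nonnegative and a negative multiple of \<open>ip u u\<close>.\<close>
        have "ip w w = ip w (T u) - a * ip w u" by (simp add: w_def bil)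
        also have "\<dots> = ip (T w - a *\<^sub>R w) u" using sym[OF wU uU] by (simp add: bil)
        also have "\<dots> = - (b\<^sup>2 * ip u u)" by (simp add: Tw bil)
        finally have "ip w w = - (b\<^sup>2 * ip u u)" .
        moreover have "0 \<le> ip w w" using pos wU bil by (cases "w = 0") (auto simp: less_imp_le)
        ultimately have "ip u u \<le> 0" using quadratic(1)
          by (simp add: mult_le_0_iff)
        then have "poly_op T q v = 0" using definite uU by (simp add: u_def)
        then show ?thesis using less.hyps[OF deg q] less.prems by blast
      qed
    qed
  qed
  moreover have "(T ^^ n) v \<in> span S" for n
  proof -
    have "(T ^^ n) v \<in> U" using inv v by (induction n) auto
    then show ?thesis using fin by blast
  qed
  ultimately show ?thesis using annihilating_poly_exists[OF T fin(1)] v by blast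
qed

text \<open>Commuting operators preserve each other's eigenspaces. So the joint eigenspaces \<open>W\<close> of the
  operators in \<open>J\<close> are invariant under \<open>M j\<close>, and the spectral theorem for \<open>M j\<close> on \<open>W\<close> splits them
  further.\<close>

lemma span_joint_eigenvectors:
  fixes M :: "'i \<Rightarrow> 'a \<Rightarrow> 'a"
  assumes "finite J"
    and M: "\<And>i. linear (M i)" and inv: "\<And>i u. u \<in> U \<Longrightarrow> M i u \<in> U"
    and sym: "\<And>i u v. u \<in> U \<Longrightarrow> v \<in> U \<Longrightarrow> ip (M i u) v = ip u (M i v)"
    and commute: "\<And>i j u. u \<in> U \<Longrightarrow> M i (M j u) = M j (M i u)"
    and fin: "finite S" "U \<subseteq> span S"
  shows "U \<subseteq> span {u \<in> U. \<forall>i\<in>J. \<exists>c. M i u = c *\<^sub>R u}"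
  using \<open>finite J\<close>
proof (induction J)
  case empty
  then show ?case using span_superset by auto
next
  case (insert j J)
  have "u \<in> span {u \<in> U. \<forall>i\<in>insert j J. \<exists>c. M i u = c *\<^sub>R u}"
    if u: "u \<in> U" and eig: "\<forall>i\<in>J. \<exists>c. M i u = c *\<^sub>R u" for u
  proof -
    obtain \<xi> where \<xi>: "\<And>i. i \<in> J \<Longrightarrow> M i u = \<xi> i *\<^sub>R u"
      using eig by metis
    define W where "W = {w \<in> U. \<forall>i\<in>J. M i w = \<xi> i *\<^sub>R w}"
    have W: "subspace W"
      unfolding W_def using U
      by (auto simp: subspace_def linear_0[OF M] linear_add[OF M] linear_scale[OF M] algebra_simps)
    interpret W: positive_definite_form W ip
      using positive_definite_form_subspace[OF W] by (auto simp: W_def)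
    have "M j w \<in> W" if "w \<in> W" for w
    proof -
      have "w \<in> U" using that by (simp add: W_def)
      then have "M i (M j w) = M j (M i w)" for i by (rule commute)
      then show ?thesis using that inv by (auto simp: W_def linear_scale[OF M])
    qed
    then have "u \<in> span {w \<in> W. \<exists>c. M j w = c *\<^sub>R w}"
      using u \<xi> fin sym by (intro W.span_eigenvectors_symmetric[of "M j" S]) (auto simp: M W_def)
    moreover have "{w \<in> W. \<exists>c. M j w = c *\<^sub>R w} \<subseteq> {u \<in> U. \<forall>i\<in>insert j J. \<exists>c. M i u = c *\<^sub>R u}"
      by (auto simp: W_def)
    ultimately show ?thesis using span_mono by blast
  qed
  then have "{u \<in> U. \<forall>i\<in>J. \<exists>c. M i u = c *\<^sub>R u} \<subseteq> span {u \<in> U. \<forall>i\<in>insert j J. \<exists>c. M i u = c *\<^sub>R u}"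
    by auto
  then have "span {u \<in> U. \<forall>i\<in>J. \<exists>c. M i u = c *\<^sub>R u} \<subseteq> span {u \<in> U. \<forall>i\<in>insert j J. \<exists>c. M i u = c *\<^sub>R u}"
    by (simp add: span_minimal)
  then show ?case using insert.IH by blast
qed

text \<open>Joint eigenvectors with the same tuple \<open>\<xi>\<close> of eigenvalues are collected in one summand \<open>e \<xi>\<close>; two
  summands with different tuples are then orthogonal, by symmetry of an operator that tells the tuples
  apart. Indexing the summands by points of \<open>real ^ 'n\<close> is the aim of this form: for multiplication
  operators the tuples are the points at which polynomials get evaluated.\<close>

lemma joint_eigenvector_decomposition:
  fixes M :: "'n::finite \<Rightarrow> 'a \<Rightarrow> 'a"
  assumes M: "\<And>i. linear (M i)" and inv: "\<And>i u. u \<in> U \<Longrightarrow> M i u \<in> U"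
    and sym: "\<And>i u v. u \<in> U \<Longrightarrow> v \<in> U \<Longrightarrow> ip (M i u) v = ip u (M i v)"
    and commute: "\<And>i j u. u \<in> U \<Longrightarrow> M i (M j u) = M j (M i u)"
    and fin: "finite S" "U \<subseteq> span S"
    and v: "v \<in> U"
  obtains \<Xi> :: "(real ^ 'n) set" and e where "finite \<Xi>" "v = (\<Sum>\<xi>\<in>\<Xi>. e \<xi>)"
    "\<And>\<xi>. \<xi> \<in> \<Xi> \<Longrightarrow> e \<xi> \<in> U" "\<And>\<xi>. \<xi> \<in> \<Xi> \<Longrightarrow> e \<xi> \<noteq> 0"
    "\<And>\<xi> i. \<xi> \<in> \<Xi> \<Longrightarrow> M i (e \<xi>) = \<xi> $ i *\<^sub>R e \<xi>"
    "\<And>\<xi> \<eta>. \<xi> \<in> \<Xi> \<Longrightarrow> \<eta> \<in> \<Xi> \<Longrightarrow> \<xi> \<noteq> \<eta> \<Longrightarrow> ip (e \<xi>) (e \<eta>) = 0"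
proof -
  define good where "good e \<longleftrightarrow> (\<forall>\<xi>. e \<xi> \<in> U \<and> (\<forall>i. M i (e \<xi>) = \<xi> $ i *\<^sub>R e \<xi>))" for e :: "real ^ 'n \<Rightarrow> 'a"
  have "\<exists>e \<Xi>. good e \<and> finite \<Xi> \<and> (\<forall>\<xi>. \<xi> \<notin> \<Xi> \<longrightarrow> e \<xi> = 0) \<and> w = (\<Sum>\<xi>\<in>\<Xi>. e \<xi>)"
    if "w \<in> span {u \<in> U. \<forall>i\<in>UNIV. \<exists>c. M i u = c *\<^sub>R u}" for w
    using that
  proof (induction rule: span_induct_alt)
    case base
    show ?case using U
      by (intro exI[of _ "\<lambda>_. 0"] exI[of _ "{}"]) (auto simp: good_def subspace_0 linear_0[OF M])
  next
    case (step c x y)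
    then obtain e \<Xi> where e: "good e" "finite \<Xi>" "\<forall>\<xi>. \<xi> \<notin> \<Xi> \<longrightarrow> e \<xi> = 0" "y = (\<Sum>\<xi>\<in>\<Xi>. e \<xi>)" by blast
    have "\<forall>i. \<exists>c. M i x = c *\<^sub>R x" using step by simp
    then obtain z where z: "\<And>i. M i x = z i *\<^sub>R x" by metis
    define \<zeta> :: "real ^ 'n" where "\<zeta> = (\<chi> i. z i)"
    define e' where "e' = e(\<zeta> := c *\<^sub>R x + e \<zeta>)"
    have xU: "x \<in> U" using step by simp
    have "good e'"
      using e(1) xU U by (auto simp: good_def e'_def \<zeta>_def subspace_add subspace_scale linear_add[OF M]
          linear_scale[OF M] z algebra_simps)
    moreover have "c *\<^sub>R x + y = (\<Sum>\<xi>\<in>insert \<zeta> \<Xi>. e' \<xi>)"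
    proof -
      have "y = (\<Sum>\<xi>\<in>insert \<zeta> \<Xi>. e \<xi>)"
        using e by (cases "\<zeta> \<in> \<Xi>") (auto simp: insert_absorb)
      also have "\<dots> = e \<zeta> + (\<Sum>\<xi>\<in>\<Xi> - {\<zeta>}. e \<xi>)" using e(2) by (simp add: sum.insert_remove)
      also have "(\<Sum>\<xi>\<in>\<Xi> - {\<zeta>}. e \<xi>) = (\<Sum>\<xi>\<in>\<Xi> - {\<zeta>}. e' \<xi>)" by (intro sum.cong) (auto simp: e'_def)
      finally have "c *\<^sub>R x + y = e' \<zeta> + (\<Sum>\<xi>\<in>\<Xi> - {\<zeta>}. e' \<xi>)" by (simp add: e'_def)
      then show ?thesis using e(2) by (simp add: sum.insert_remove)
    qed
    moreover have "\<forall>\<xi>. \<xi> \<notin> insert \<zeta> \<Xi> \<longrightarrow> e' \<xi> = 0" using e(3) by (simp add: e'_def)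
    ultimately show ?case using finite.insertI[OF e(2)] by blast
  qed
  moreover have "v \<in> span {u \<in> U. \<forall>i\<in>UNIV. \<exists>c. M i u = c *\<^sub>R u}"
    using span_joint_eigenvectors[of UNIV M S, OF _ M inv sym commute fin] v by auto
  ultimately obtain e \<Xi> where e: "good e" "finite \<Xi>" "\<forall>\<xi>. \<xi> \<notin> \<Xi> \<longrightarrow> e \<xi> = 0" "v = (\<Sum>\<xi>\<in>\<Xi>. e \<xi>)"
    by blast
  have "ip (e \<xi>) (e \<eta>) = 0" if "\<xi> \<noteq> \<eta>" for \<xi> \<eta>
  proof -
    obtain i where i: "\<xi> $ i \<noteq> \<eta> $ i" using \<open>\<xi> \<noteq> \<eta>\<close> by (auto simp: vec_eq_iff)
    have "e \<xi> \<in> U" "e \<eta> \<in> U" using e(1) by (simp_all add: good_def)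
    then have "ip (M i (e \<xi>)) (e \<eta>) = ip (e \<xi>) (M i (e \<eta>))" by (rule sym)
    then have "\<xi> $ i * ip (e \<xi>) (e \<eta>) = \<eta> $ i * ip (e \<xi>) (e \<eta>)"
      using e(1) by (simp add: good_def bilinear_lmul[OF bilin] bilinear_rmul[OF bilin])
    then show ?thesis using i by simp
  qed
  moreover have "v = (\<Sum>\<xi>\<in>{\<xi> \<in> \<Xi>. e \<xi> \<noteq> 0}. e \<xi>)"
    unfolding e(4) using e(2) by (intro sum.mono_neutral_right) auto
  moreover have "e \<xi> \<in> U" "M i (e \<xi>) = \<xi> $ i *\<^sub>R e \<xi>" for i \<xi>
    using e(1) unfolding good_def by blast+
  moreover have "finite {\<xi> \<in> \<Xi>. e \<xi> \<noteq> 0}" using e(2) by simp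
  ultimately show thesis by (intro that[of "{\<xi> \<in> \<Xi>. e \<xi> \<noteq> 0}" e]) blast+
qed

end

section \<open>Evaluation, monomials and ideals\<close>

lemma scaleR_eq_mult_const: "c *\<^sub>R (p :: 'n rpoly) = Poly_Mapping.single 0 c * p"
proof -
  have "(*\<^sub>R) c = (*) (c :: real)" by (simp add: fun_eq_iff)
  then show ?thesis unfolding scaleR_poly_mapping_def by (simp add: mult_map_scale_conv_mult)
qed

lemma const_eq_scaleR_1: "Poly_Mapping.single 0 c = c *\<^sub>R (1 :: 'n rpoly)"
  by (simp add: scaleR_eq_mult_const)

lemma mult_scaleR_left_rpoly [simp]: "(c *\<^sub>R p) * q = c *\<^sub>R (p * q)" for p q :: "'n rpoly"
  by (simp add: scaleR_eq_mult_const mult.assoc)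

lemma mult_scaleR_right_rpoly [simp]: "p * (c *\<^sub>R q) = c *\<^sub>R (p * q)" for p q :: "'n rpoly"
  by (simp add: scaleR_eq_mult_const mult.left_commute)

lemma bilinear_times_rpoly: "bilinear (\<lambda>p q :: 'n rpoly. p * q)"
  unfolding bilinear_def by (auto intro!: linearI simp: algebra_simps)

lemma rpoly_in_span_monomials: "(p :: 'n rpoly) \<in> span monomials"
proof -
  have "p = (\<Sum>\<alpha>\<in>Poly_Mapping.keys p. Poly_Mapping.lookup p \<alpha> *\<^sub>R Poly_Mapping.single \<alpha> 1)"
    by (intro poly_mapping_eqI) (simp add: lookup_sum lookup_single when_def in_keys_iff if_distrib cong: if_cong)
  also have "\<dots> \<in> span monomials"
    by (intro span_sum span_scale span_base) (auto simp: monomials_def)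
  finally show ?thesis .
qed

lemma linear_peval: "linear (\<lambda>p. peval p x)"
proof (rule linearI)
  define m where "m \<alpha> = (\<Prod>i\<in>UNIV. (x $ i) ^ Poly_Mapping.lookup \<alpha> i)" for \<alpha>
  have sup: "peval p x = (\<Sum>\<alpha>\<in>A. Poly_Mapping.lookup p \<alpha> * m \<alpha>)"
    if "finite A" "Poly_Mapping.keys p \<subseteq> A" for p A
    unfolding peval_def m_def using that by (intro sum.mono_neutral_left) (auto simp: in_keys_iff)
  show "peval (p + q) x = peval p x + peval q x" for p q
  proof -
    let ?A = "Poly_Mapping.keys p \<union> Poly_Mapping.keys q"
    have "Poly_Mapping.keys (p + q) \<subseteq> ?A" by (rule keys_add)
    then show ?thesis by (simp add: sup[of ?A] lookup_add algebra_simps sum.distrib)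
  qed
  show "peval (c *\<^sub>R p) x = c *\<^sub>R peval p x" for c p
  proof -
    have "Poly_Mapping.keys (c *\<^sub>R p) \<subseteq> Poly_Mapping.keys p" by (auto simp: in_keys_iff)
    then show ?thesis
      by (simp add: sup[of "Poly_Mapping.keys p"] sum_distrib_left mult.assoc)
  qed
qed

lemma peval_monomial:
  "peval (Poly_Mapping.single \<alpha> 1) x = (\<Prod>i\<in>UNIV. (x $ i) ^ Poly_Mapping.lookup \<alpha> i)"
  by (simp add: peval_def)

lemma peval_1 [simp]: "peval 1 x = 1"
  using peval_monomial[of 0 x] by simp

lemma peval_pvar [simp]: "peval (pvar i) x = x $ i"
proof -
  have "peval (pvar i) x = (\<Prod>j\<in>UNIV. if j = i then x $ i else 1)"
    unfolding pvar_def peval_monomial by (intro prod.cong) (auto simp: lookup_single when_def)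
  then show ?thesis by simp
qed

lemma peval_mult [simp]: "peval (p * q) x = peval p x * peval q x"
proof -
  have "bilinear (\<lambda>p q. peval (p * q) x)" "bilinear (\<lambda>p q. peval p x * peval q x)"
    using linear_compose[OF _ linear_peval[of x]] bilinear_times_rpoly linear_peval[of x]
    by (auto simp: bilinear_def o_def linear_iff algebra_simps)
  moreover have "peval (p * q) x = peval p x * peval q x"
    if "p \<in> monomials" "q \<in> monomials" for p q
    using that by (auto simp: monomials_def mult_single peval_monomial lookup_add power_add prod.distrib)
  ultimately show ?thesis
    using bilinear_eq[of "\<lambda>p q. peval (p * q) x" "\<lambda>p q. peval p x * peval q x"
        UNIV monomials UNIV monomials p q] rpoly_in_span_monomials by blast
qed

lemmas peval_linear_simps [simp] =
  linear_0[OF linear_peval] linear_add[OF linear_peval] linear_diff[OF linear_peval]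
  linear_scale[OF linear_peval] linear_sum[OF linear_peval]

lemma monomials_induct [consumes 1, case_names one pvar]:
  assumes "m \<in> monomials" and "P 1" and "\<And>i m. m \<in> monomials \<Longrightarrow> P m \<Longrightarrow> P (pvar i * m)"
  shows "P (m :: 'n::finite rpoly)"
proof -
  have "P (Poly_Mapping.single \<alpha> 1)" for \<alpha> :: "'n \<Rightarrow>\<^sub>0 nat"
  proof (induction "\<Sum>i\<in>UNIV. Poly_Mapping.lookup \<alpha> i" arbitrary: \<alpha>)
    case 0
    then have "\<alpha> = 0" by (intro poly_mapping_eqI) simp
    then show ?case using assms(2) by simp
  next
    case (Suc n)
    then obtain i where i: "Poly_Mapping.lookup \<alpha> i > 0"
      by (metis (no_types, lifting) gr0I sum.neutral Zero_not_Suc)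
    define \<beta> where "\<beta> = \<alpha> - Poly_Mapping.single i 1"
    have \<alpha>: "\<alpha> = Poly_Mapping.single i 1 + \<beta>"
      using i unfolding \<beta>_def by (intro poly_mapping_eqI) (auto simp: lookup_add lookup_minus lookup_single when_def)
    have "(\<Sum>i\<in>UNIV. Poly_Mapping.lookup \<alpha> i) = 1 + (\<Sum>i\<in>UNIV. Poly_Mapping.lookup \<beta> i)"
      by (simp add: \<alpha> lookup_add sum.distrib lookup_single when_def)
    then have "P (Poly_Mapping.single \<beta> 1)" using Suc by simp
    then have "P (pvar i * Poly_Mapping.single \<beta> 1)" by (intro assms(3)) (auto simp: monomials_def)
    then show ?case by (simp add: pvar_def mult_single \<alpha>)
  qed
  then show ?thesis using assms(1) by (auto simp: monomials_def)
qed

text \<open>Each passage from \<open>pvar i * m'\<close> to \<open>m'\<close> lowers the total degree, so a descent inside \<open>B\<close> ends at 1.\<close>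

lemma connected_to_1_induct [consumes 2, case_names one pvar]:
  assumes "connected_to_1 B" "m \<in> B" and "P 1"
    and step: "\<And>i m'. m' \<in> B \<Longrightarrow> pvar i * m' \<in> B \<Longrightarrow> P m' \<Longrightarrow> P (pvar i * m')"
  shows "P (m :: 'n::finite rpoly)"
proof -
  have "P m" if "m = Poly_Mapping.single \<alpha> 1" "m \<in> B" for m and \<alpha> :: "'n \<Rightarrow>\<^sub>0 nat"
    using that
  proof (induction "\<Sum>i\<in>UNIV. Poly_Mapping.lookup \<alpha> i" arbitrary: m \<alpha> rule: less_induct)
    case less
    show ?case
    proof (cases "m = 1")
      case False
      then obtain i m' where m: "m' \<in> B" "m = pvar i * m'"
        using assms(1) less.prems unfolding connected_to_1_def by blast
      then obtain \<beta> where \<beta>: "m' = Poly_Mapping.single \<beta> 1"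
        using assms(1) unfolding connected_to_1_def monomials_def by blast
      \<comment> \<open>The exponent vector is recovered from the monomial as its only key.\<close>
      have "Poly_Mapping.single \<alpha> (1::real) = Poly_Mapping.single (Poly_Mapping.single i 1 + \<beta>) 1"
        using m \<beta> less.prems by (simp add: pvar_def mult_single)
      then have "Poly_Mapping.keys (Poly_Mapping.single \<alpha> (1::real))
          = Poly_Mapping.keys (Poly_Mapping.single (Poly_Mapping.single i 1 + \<beta>) (1::real))" by simp
      then have "\<alpha> = Poly_Mapping.single i 1 + \<beta>" by simp
      then have "(\<Sum>i\<in>UNIV. Poly_Mapping.lookup \<beta> i) < (\<Sum>i\<in>UNIV. Poly_Mapping.lookup \<alpha> i)"
        by (simp add: lookup_add sum.distrib lookup_single when_def)
      then have "P m'" using less.hyps \<beta> m(1) by metis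
      then show ?thesis using step[OF m(1)] less.prems(2) unfolding m(2) by metis
    qed (simp add: assms)
  qed
  then show ?thesis using assms(1,2) unfolding connected_to_1_def monomials_def by blast
qed

text \<open>The ring as a module over itself: its spans are the ideals.\<close>

interpretation rpoly_module: module "(*) :: 'n rpoly \<Rightarrow> 'n rpoly \<Rightarrow> 'n rpoly"
  by (rule module_times)

lemma ideal_gen_props:
  fixes S :: "'n rpoly set"
  shows "p \<in> S \<Longrightarrow> p \<in> ideal_gen S" "0 \<in> ideal_gen S"
    "p \<in> ideal_gen S \<Longrightarrow> q \<in> ideal_gen S \<Longrightarrow> p + q \<in> ideal_gen S"
    "q \<in> ideal_gen S \<Longrightarrow> r * q \<in> ideal_gen S"
    "q \<in> ideal_gen S \<Longrightarrow> c *\<^sub>R q \<in> ideal_gen S"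
  unfolding ideal_gen_def
  by (simp_all add: rpoly_module.span_base rpoly_module.span_zero rpoly_module.span_add
      rpoly_module.span_scale scaleR_eq_mult_const)

lemma ideal_gen_least:
  assumes "S \<subseteq> I_min f"
  shows "ideal_gen S \<subseteq> I_min f"
  unfolding ideal_gen_def using assms
  by (intro rpoly_module.span_minimal) (auto simp: rpoly_module.subspace_def I_min_def)

lemma products_span_subset: "products (span P) \<subseteq> span (products P)"
proof -
  have left: "p * q \<in> span (products P)" if "p \<in> span P" "q \<in> P" for p q
    using that(1)
  proof (induction rule: span_induct_alt)
    case (step c x y)
    then have "x * q \<in> span (products P)"
      using that(2) by (intro span_base) (auto simp: products_def)
    then show ?case using step by (simp add: distrib_right span_add span_scale)
  qed (simp add: span_zero)
  have "p * q \<in> span (products P)" if "p \<in> span P" "q \<in> span P" for p q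
    using that(2)
  proof (induction rule: span_induct_alt)
    case (step c x y)
    then show ?case using that(1) left by (simp add: distrib_left span_add span_scale)
  qed (simp add: span_zero)
  then show ?thesis by (auto simp: products_def)
qed

lemma span_products_span: "span (products (span P)) = span (products P)"
proof
  show "span (products (span P)) \<subseteq> span (products P)"
    using products_span_subset by (intro span_minimal) simp_all
  show "span (products P) \<subseteq> span (products (span P))"
    by (intro span_mono) (auto simp: products_def intro: span_base)
qed

lemma finite_products: "finite P \<Longrightarrow> finite (products P)"
proof -
  assume "finite P"
  moreover have "products P = (\<lambda>(p, q). p * q) ` (P \<times> P)" by (auto simp: products_def)
  ultimately show ?thesis by simp
qed

lemma finite_plus_set: "finite B \<Longrightarrow> finite (plus_set (B :: 'n::finite rpoly set))"
  by (simp add: plus_set_def)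

section \<open>Ranks of Hankel operators\<close>

text \<open>Both the set \<open>B\<close> and its image contain bases of their spans; if the image has dimension \<open>card B\<close>,
  then these bases cannot be proper subsets.\<close>

lemma dim_image_eq_card_imp:
  fixes H :: "'a::real_vector \<Rightarrow> 'b::real_vector"
  assumes H: "linear H" and "finite B" and dim: "dim (H ` span B) = card B"
  shows "independent B" "inj_on H (span B)"
proof -
  have dimHB: "dim (H ` B) = card B"
    using dim by (metis linear_span_image[OF H] dim_span)
  obtain I where I: "I \<subseteq> B" "independent I" "B \<subseteq> span I"
    using maximal_independent_subset by blast
  have "H ` B \<subseteq> span (H ` I)" using I(3) by (auto simp: linear_span_image[OF H])
  then have "card B \<le> card (H ` I)"
    using dim_le_card[of "H ` B" "H ` I"] dimHB I(1) \<open>finite B\<close> by (auto dest: finite_subset)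
  also have "\<dots> \<le> card I" using I(1) \<open>finite B\<close> by (auto intro: card_image_le dest: finite_subset)
  finally have "I = B" using I(1) \<open>finite B\<close> by (simp add: card_seteq)
  then show "independent B" using I by simp
  obtain J where J: "J \<subseteq> H ` B" "independent J" "H ` B \<subseteq> span J" "card J = dim (H ` B)"
    using basis_exists by blast
  have "card (H ` B) \<le> card J" using J(4) dimHB card_image_le[OF \<open>finite B\<close>] by simp
  then have "J = H ` B" using J(1) \<open>finite B\<close> by (simp add: card_seteq)
  moreover from this have "inj_on H B" using J(4) dimHB \<open>finite B\<close> by (simp add: eq_card_imp_inj_on)
  ultimately show "inj_on H (span B)" using J(2) by (simp add: linear_inj_on_span_independent_image[OF H])
qed

text \<open>The image of \<open>B\<close> is independent, and the dimension bound leaves no room for a further independent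
  vector in the image of the larger space.\<close>

lemma image_span_subset_if_dim_le:
  fixes H :: "'a::real_vector \<Rightarrow> 'b::real_vector"
  assumes H: "linear H" and "independent B" and inj: "inj_on H (span B)"
    and "finite P" "B \<subseteq> P" and dim: "dim (H ` span P) \<le> card B"
  shows "H ` span P \<subseteq> H ` span B"
proof
  fix y assume y: "y \<in> H ` span P"
  have ind: "independent (H ` B)" by (rule linear_independent_injective_image[OF H assms(2) inj])
  have "inj_on H B" by (rule inj_on_subset[OF inj span_superset])
  then have card: "card (H ` B) = card B" by (rule card_image)
  have fin: "finite (H ` P)" "finite (H ` B)" using \<open>finite P\<close> \<open>B \<subseteq> P\<close> by (auto dest: finite_subset)
  show "y \<in> H ` span B"
  proof (rule ccontr)
    assume "y \<notin> H ` span B"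
    then have ny: "y \<notin> span (H ` B)" by (simp add: linear_span_image[OF H])
    then have indy: "independent (insert y (H ` B))" using ind by (simp add: independent_insert)
    have "insert y (H ` B) \<subseteq> H ` span P" using y \<open>B \<subseteq> P\<close> by (auto intro: span_base)
    then obtain J where J: "insert y (H ` B) \<subseteq> J" "J \<subseteq> H ` span P" "independent J" "H ` span P \<subseteq> span J"
      using maximal_independent_subset_extend[OF _ indy] by blast
    have "J \<subseteq> span (H ` P)" using J(2) by (simp add: linear_span_image[OF H])
    then have finJ: "finite J" using independent_span_bound[OF fin(1) J(3)] by blast
    have "card J = dim (H ` span P)" using basis_card_eq_dim[OF J(2,4,3)] .
    moreover have "card (insert y (H ` B)) \<le> card J" using J(1) finJ by (rule card_mono[rotated])
    moreover have "y \<notin> H ` B" using ny by (auto intro: span_base)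
    then have "card (insert y (H ` B)) = Suc (card B)" using fin(2) card by simp
    ultimately show False using dim by linarith
  qed
qed

lemma linear_hankel:
  assumes "linear L"
  shows "linear (hankel V L)"
  using assms by (auto intro!: linearI simp: hankel_def fun_eq_iff scaleR_fun_def
      distrib_right linear_add linear_scale)

lemma hankel_ker_eq: "hankel_ker V L = {p \<in> V. hankel V L p = 0}"
  by (auto simp: hankel_ker_def hankel_def fun_eq_iff split: if_splits)

text \<open>Only the values of a form on products of elements of \<open>E\<close> enter its truncated Hankel operators.\<close>

lemma hankel_cong:
  assumes "\<And>p. p \<in> span (products E) \<Longrightarrow> L p = \<Lambda> p" and "V \<subseteq> E" "p \<in> V"
  shows "hankel V L p = hankel V \<Lambda> p"
proof -
  have "p * q \<in> span (products E)" if "q \<in> V" for q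
    using assms(2,3) that by (intro span_base) (auto simp: products_def)
  then show ?thesis using assms(1) by (auto simp: hankel_def)
qed

lemma hankel_rank_cong:
  assumes "\<And>p. p \<in> span (products E) \<Longrightarrow> L p = \<Lambda> p" and "V \<subseteq> E"
  shows "hankel_rank V L = hankel_rank V \<Lambda>"
proof -
  have "hankel V L ` V = hankel V \<Lambda> ` V" using hankel_cong[OF assms] by (intro image_cong) auto
  then show ?thesis by (simp add: hankel_rank_def)
qed

lemma hankel_ker_cong:
  assumes "\<And>p. p \<in> span (products E) \<Longrightarrow> L p = \<Lambda> p"
  shows "hankel_ker E L = hankel_ker E \<Lambda>"
proof -
  have "hankel E L p = hankel E \<Lambda> p" if "p \<in> E" for p
    by (rule hankel_cong[OF assms subset_refl that])
  then show ?thesis by (auto simp: hankel_ker_eq)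
qed

text \<open>The degenerate case of the Cauchy-Schwarz inequality: if \<open>L (p * q) \<noteq> 0\<close>, then
  \<open>L ((q + t *\<^sub>R p) * (q + t *\<^sub>R p))\<close> is negative for a suitable \<open>t\<close>.\<close>

lemma psd_cauchy_schwarz_null:
  fixes L :: "'n rpoly \<Rightarrow> real"
  assumes L: "linear L" and V: "subspace V" and psd: "\<And>p. p \<in> V \<Longrightarrow> 0 \<le> L (p * p)"
    and p: "p \<in> V" "L (p * p) \<le> 0" and q: "q \<in> V"
  shows "L (p * q) = 0"
proof (rule ccontr)
  assume ne: "L (p * q) \<noteq> 0"
  \<comment> \<open>the value of \<open>t\<close> for which \<open>L (q * q) + 2 * t * L (p * q) = -1\<close>\<close>
  define t where "t = - (L (q * q) + 1) / (2 * L (p * q))"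
  have "(q + t *\<^sub>R p) * (q + t *\<^sub>R p) = q * q + t *\<^sub>R (p * q) + t *\<^sub>R (p * q) + (t * t) *\<^sub>R (p * p)"
    by (simp only: distrib_left distrib_right mult_scaleR_left_rpoly mult_scaleR_right_rpoly
        scaleR_scaleR scaleR_add_right mult.commute[of q p] add.assoc)
  then have "L ((q + t *\<^sub>R p) * (q + t *\<^sub>R p)) = L (q * q) + t * L (p * q) + t * L (p * q) + t * t * L (p * p)"
    by (simp only: linear_add[OF L] linear_scale[OF L] real_scaleR_def)
  moreover have "t * L (p * q) = - (L (q * q) + 1) / 2" using ne by (simp add: t_def)
  ultimately have "L ((q + t *\<^sub>R p) * (q + t *\<^sub>R p)) = t * t * L (p * p) - 1" by simp
  moreover have "t * t * L (p * p) \<le> 0" using p(2) by (simp add: mult_nonneg_nonpos)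
  moreover have "0 \<le> L ((q + t *\<^sub>R p) * (q + t *\<^sub>R p))"
    using p q V by (intro psd) (simp add: subspace_add subspace_scale)
  ultimately show False by simp
qed

section \<open>Flat forms are sums of point evaluations\<close>

text \<open>Positive definiteness makes \<open>span B\<close> meet the kernel of the Hankel operator only in 0. With the last
  assumption, the space spanned by \<open>plus_set B\<close> is thus the direct sum of the two, which is the form in which
  the rank condition of a flat extension gets used.\<close>

locale flat_form =
  fixes B :: "'n::finite rpoly set" and L :: "'n rpoly \<Rightarrow> real"
  assumes finite: "finite B" and connected: "connected_to_1 B" and linear: "linear L"
    and pos_def: "\<And>p. p \<in> span B \<Longrightarrow> p \<noteq> 0 \<Longrightarrow> 0 < L (p * p)"
    and flat: "\<And>p. p \<in> span (plus_set B) \<Longrightarrow>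
      \<exists>a\<in>span B. p - a \<in> hankel_ker (span (plus_set B)) L"
begin

abbreviation "A \<equiv> span B"
abbreviation "E \<equiv> span (plus_set B)"
abbreviation "K \<equiv> hankel_ker E L"

lemma A_subset_E: "A \<subseteq> E"
  by (intro span_mono) (auto simp: plus_set_def)

lemma one_in_A: "1 \<in> A"
  using connected by (intro span_base) (simp add: connected_to_1_def)

lemma pvar_mult_in_E: "a \<in> A \<Longrightarrow> pvar i * a \<in> E"
proof (induction rule: span_induct_alt)
  case (step c x y)
  then have "pvar i * x \<in> E" by (intro span_base) (auto simp: plus_set_def)
  then show ?case using step by (simp add: distrib_left span_add span_scale)
qed (simp add: span_zero)

lemma K_orthogonal: "p \<in> K \<Longrightarrow> q \<in> E \<Longrightarrow> L (p * q) = 0"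
  by (simp add: hankel_ker_def)

sublocale positive_definite_form A "\<lambda>p q. L (p * q)"
proof
  show "bilinear (\<lambda>p q. L (p * q))"
    unfolding bilinear_def using linear
    by (auto intro!: linearI simp: linear_add linear_scale algebra_simps)
qed (simp_all add: mult.commute pos_def)

lemma nondegenerate:
  assumes "a \<in> A" "b \<in> A" "\<And>v. v \<in> A \<Longrightarrow> L (a * v) = L (b * v)"
  shows "a = b"
proof -
  have ab: "a - b \<in> A" using assms by (simp add: span_diff)
  then have "L ((a - b) * (a - b)) = 0"
    using assms(3)[of "a - b"] by (simp add: left_diff_distrib[of a b "a - b"] linear_diff[OF linear])
  then show ?thesis using definite[OF ab] by fastforce
qed

text \<open>The Hankel operator on \<open>E\<close> vanishes exactly on \<open>K\<close> and is injective on \<open>A\<close>. Composing it with a left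
  inverse on \<open>A\<close> therefore projects \<open>E = A + K\<close> onto \<open>A\<close> along \<open>K\<close>, by a linear map that is defined
  everywhere.\<close>

lemma projection_exists:
  obtains \<pi> where "linear \<pi>" "\<And>p. \<pi> p \<in> A" "\<And>a. a \<in> A \<Longrightarrow> \<pi> a = a" "\<And>p. p \<in> E \<Longrightarrow> p - \<pi> p \<in> K"
proof -
  let ?H = "hankel E L"
  have H: "linear ?H" by (rule linear_hankel[OF linear])
  have inj: "inj_on ?H A"
  proof (subst linear_injective_on_subspace_0[OF H], simp, intro ballI impI)
    fix a assume a: "a \<in> A" "?H a = 0"
    then have "a \<in> K" using A_subset_E by (auto simp: hankel_ker_eq)
    then have "L (a * v) = L (0 * v)" if "v \<in> A" for v
      using K_orthogonal A_subset_E that by (auto simp: linear_0[OF linear])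
    then show "a = 0" using a by (intro nondegenerate) (auto simp: span_zero)
  qed
  obtain g where g: "range g \<subseteq> A" "linear g" "\<forall>a\<in>A. g (?H a) = a"
    using linear_exists_left_inverse_on[OF H subspace_span inj] by blast
  show thesis
  proof (rule that[of "g \<circ> ?H"])
    show "linear (g \<circ> ?H)" by (rule linear_compose[OF H g(2)])
    show "p - (g \<circ> ?H) p \<in> K" if p: "p \<in> E" for p
    proof -
      obtain a where a: "a \<in> A" "p - a \<in> K" using flat p by blast
      then have "?H p = ?H a" by (simp add: hankel_ker_eq linear_diff[OF H])
      then show ?thesis using a g(3) by simp
    qed
  qed (use g in auto)
qed

text \<open>Let \<open>\<pi>\<close> be the projection of \<open>E\<close> onto \<open>A\<close> along \<open>K\<close>, and let \<open>M i\<close> be multiplication by the variable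
  \<open>i\<close> on \<open>A\<close> followed by \<open>\<pi>\<close>. As \<open>K\<close> is orthogonal to \<open>E\<close>, the inner products of \<open>M i u\<close> with \<open>v\<close> and of
  \<open>M i (M j u)\<close> with \<open>v\<close> are the values of \<open>L\<close> at \<open>pvar i * u * v\<close> and at
  \<open>(pvar j * u) * (pvar i * v)\<close>. So the \<open>M i\<close> are symmetric and commute, and 1 is a sum of orthogonal
  joint eigenvectors \<open>e \<xi>\<close>.

  The map \<open>\<phi>\<close> sends \<open>p\<close> to what the polynomial \<open>p\<close> in the operators \<open>M i\<close> does to 1; on the
  eigenvectors it is evaluation of \<open>p\<close> at \<open>\<xi>\<close>, which serves as its definition. Since \<open>B\<close> is connected
  to 1, \<open>\<phi>\<close> fixes \<open>B\<close> and agrees with \<open>\<pi>\<close> on \<open>E\<close>. Hence \<open>L (p * q)\<close> is the inner product of \<open>\<phi> p\<close> and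
  \<open>\<phi> q\<close>, a sum of point evaluations with the weights \<open>L (e \<xi> * e \<xi>) > 0\<close>. Moreover \<open>\<phi> p\<close> is a remainder of
  \<open>p\<close> modulo the ideal of \<open>K\<close>, because each multiplication by a variable changes it by an element of \<open>K\<close>.\<close>

lemma atomic_representation:
  obtains \<Xi> w where "finite \<Xi>" "\<And>\<xi>. \<xi> \<in> \<Xi> \<Longrightarrow> 0 < w \<xi>"
    "\<And>p. p \<in> span (products E) \<Longrightarrow> L p = (\<Sum>\<xi>\<in>\<Xi>. w \<xi> * peval p \<xi>)"
    "\<And>p. (\<And>\<xi>. \<xi> \<in> \<Xi> \<Longrightarrow> peval p \<xi> = 0) \<Longrightarrow> p \<in> ideal_gen K"
proof -
  obtain \<pi> where \<pi>: "linear \<pi>" "\<And>p. \<pi> p \<in> A" "\<And>a. a \<in> A \<Longrightarrow> \<pi> a = a"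
    and \<pi>K: "\<And>p. p \<in> E \<Longrightarrow> p - \<pi> p \<in> K"
    using projection_exists by blast
  have L\<pi>: "L (\<pi> p * q) = L (p * q)" if "p \<in> E" "q \<in> E" for p q
    using K_orthogonal[OF \<pi>K[OF that(1)] that(2)] by (simp add: left_diff_distrib linear_diff[OF linear])
  define M where "M i p = \<pi> (pvar i * p)" for i p
  have M: "linear (M i)" for i
    unfolding M_def by (intro linearI) (simp_all add: distrib_left linear_add[OF \<pi>(1)] linear_scale[OF \<pi>(1)])
  have MA: "M i p \<in> A" for i p by (simp add: M_def \<pi>)
  have LM: "L (M i u * v) = L (pvar i * u * v)" if "u \<in> A" "v \<in> E" for i u v
    using L\<pi>[OF pvar_mult_in_E[OF that(1)] that(2)] by (simp add: M_def)
  have sym: "L (M i u * v) = L (u * M i v)" if "u \<in> A" "v \<in> A" for i u v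
  proof -
    have "L (M i u * v) = L (pvar i * u * v)" using LM that A_subset_E by blast
    also have "\<dots> = L (pvar i * v * u)" by (simp only: mult_ac)
    also have "\<dots> = L (M i v * u)" using LM[OF that(2)] that A_subset_E by auto
    finally show ?thesis by (simp only: mult.commute)
  qed
  have MM: "L (M i (M j u) * v) = L ((pvar j * u) * (pvar i * v))" if "u \<in> A" "v \<in> A" for i j u v
  proof -
    have "L (M i (M j u) * v) = L (M j u * M i v)" using sym MA that by simp
    also have "\<dots> = L (pvar j * u * M i v)" using LM MA that A_subset_E by blast
    also have "\<dots> = L (M i v * (pvar j * u))" by (simp only: mult_ac)
    also have "\<dots> = L ((pvar j * u) * (pvar i * v))"
      using LM[OF that(2) pvar_mult_in_E[OF that(1)]] by (simp only: mult_ac)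
    finally show ?thesis .
  qed
  have commute: "M i (M j u) = M j (M i u)" if "u \<in> A" for i j u
  proof (intro nondegenerate MA)
    fix v assume "v \<in> A"
    then have "L (M i (M j u) * v) = L ((pvar j * u) * (pvar i * v))"
      "L (M j (M i u) * v) = L ((pvar i * u) * (pvar j * v))" using MM that by blast+
    moreover have "(pvar j * u) * (pvar i * v) = (pvar i * u) * (pvar j * v)" by (simp only: mult_ac)
    ultimately show "L (M i (M j u) * v) = L (M j (M i u) * v)" by (simp only:)
  qed
  obtain \<Xi> e where \<Xi>: "finite \<Xi>" and one: "1 = (\<Sum>\<xi>\<in>\<Xi>. e \<xi>)"
    and eA: "\<And>\<xi>. \<xi> \<in> \<Xi> \<Longrightarrow> e \<xi> \<in> A" and e0: "\<And>\<xi>. \<xi> \<in> \<Xi> \<Longrightarrow> e \<xi> \<noteq> 0"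
    and eig: "\<And>\<xi> i. \<xi> \<in> \<Xi> \<Longrightarrow> M i (e \<xi>) = \<xi> $ i *\<^sub>R e \<xi>"
    and orth: "\<And>\<xi> \<eta>. \<xi> \<in> \<Xi> \<Longrightarrow> \<eta> \<in> \<Xi> \<Longrightarrow> \<xi> \<noteq> \<eta> \<Longrightarrow> L (e \<xi> * e \<eta>) = 0"
    using joint_eigenvector_decomposition[of M B 1, OF M MA sym commute finite _ one_in_A] by blast
  define \<phi> where "\<phi> p = (\<Sum>\<xi>\<in>\<Xi>. peval p \<xi> *\<^sub>R e \<xi>)" for p
  have \<phi>: "linear \<phi>"
    unfolding \<phi>_def
    by (intro linearI) (simp_all add: scaleR_left_distrib sum.distrib scaleR_sum_right)
  have \<phi>A: "\<phi> p \<in> A" for p unfolding \<phi>_def by (intro span_sum span_scale eA)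
  have \<phi>1: "\<phi> 1 = 1" by (simp add: \<phi>_def flip: one)
  have \<phi>M: "\<phi> (pvar i * p) = M i (\<phi> p)" for i p
    by (simp add: \<phi>_def linear_sum[OF M] linear_scale[OF M] eig mult.commute)
  have \<phi>B: "\<phi> m = m" if "m \<in> B" for m
    using connected that
  proof (induction rule: connected_to_1_induct)
    case (pvar i m)
    then show ?case by (simp add: \<phi>M M_def \<pi> span_base)
  qed (rule \<phi>1)
  have \<phi>\<pi>: "\<phi> p = \<pi> p" if "p \<in> E" for p
  proof (rule linear_eq_on_span[OF \<phi> \<pi>(1) _ that])
    fix m assume "m \<in> plus_set B"
    then show "\<phi> m = \<pi> m"
      by (auto simp: plus_set_def \<phi>B \<phi>M M_def \<pi> span_base)
  qed
  define w where "w \<xi> = L (e \<xi> * e \<xi>)" for \<xi>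
  have Lpq: "L (p * q) = (\<Sum>\<xi>\<in>\<Xi>. w \<xi> * peval (p * q) \<xi>)" if p: "p \<in> E" and q: "q \<in> E" for p q
  proof -
    \<comment> \<open>Both factors may be replaced by their projections, as \<open>K\<close> is orthogonal to \<open>E\<close>.\<close>
    have "L (p * q) = L (\<pi> p * q)" using L\<pi> p q by simp
    also have "\<dots> = L (q * \<pi> p)" by (simp add: mult.commute)
    also have "\<dots> = L (\<pi> q * \<pi> p)"
      by (rule L\<pi>[OF q subsetD[OF A_subset_E \<pi>(2)], symmetric])
    also have "\<dots> = L (\<phi> q * \<phi> p)" using \<phi>\<pi> p q by simp
    also have "\<dots> = (\<Sum>\<eta>\<in>\<Xi>. \<Sum>\<xi>\<in>\<Xi>. peval p \<xi> * peval q \<eta> * L (e \<eta> * e \<xi>))"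
      by (simp add: \<phi>_def sum_product linear_sum[OF linear] linear_scale[OF linear])
    also have "\<dots> = (\<Sum>\<eta>\<in>\<Xi>. \<Sum>\<xi>\<in>\<Xi>. if \<xi> = \<eta> then peval p \<eta> * peval q \<eta> * w \<eta> else 0)"
      using orth by (intro sum.cong refl) (auto simp: w_def)
    also have "\<dots> = (\<Sum>\<xi>\<in>\<Xi>. w \<xi> * peval (p * q) \<xi>)"
      using \<Xi> by (simp add: mult_ac)
    finally show ?thesis .
  qed
  have ideal: "p - \<phi> p \<in> ideal_gen K" for p
  proof -
    have mono: "m - \<phi> m \<in> ideal_gen K" if "m \<in> monomials" for m
      using that
    proof (induction rule: monomials_induct)
      case one
      then show ?case by (simp add: \<phi>1 ideal_gen_props)
    next
      case (pvar i m)
      have "pvar i * \<phi> m - M i (\<phi> m) \<in> ideal_gen K"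
        unfolding M_def by (intro ideal_gen_props(1) \<pi>K pvar_mult_in_E \<phi>A)
      moreover have "pvar i * (m - \<phi> m) \<in> ideal_gen K" using pvar by (intro ideal_gen_props(4))
      ultimately have "pvar i * (m - \<phi> m) + (pvar i * \<phi> m - M i (\<phi> m)) \<in> ideal_gen K"
        by (intro ideal_gen_props(3))
      then show ?case by (simp add: \<phi>M right_diff_distrib)
    qed
    have "p \<in> span monomials" by (rule rpoly_in_span_monomials)
    then show ?thesis
    proof (induction rule: span_induct_alt)
      case base
      then show ?case by (simp add: linear_0[OF \<phi>] ideal_gen_props)
    next
      case (step c x y)
      have "c *\<^sub>R (x - \<phi> x) + (y - \<phi> y) \<in> ideal_gen K"
        using step mono by (intro ideal_gen_props(3,5))
      then show ?case by (simp add: linear_add[OF \<phi>] linear_scale[OF \<phi>] algebra_simps)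
    qed
  qed
  show thesis
  proof (rule that[of \<Xi> w])
    show "0 < w \<xi>" if "\<xi> \<in> \<Xi>" for \<xi> using pos_def eA e0 that by (simp add: w_def)
    show "L p = (\<Sum>\<xi>\<in>\<Xi>. w \<xi> * peval p \<xi>)" if "p \<in> span (products E)" for p
    proof (rule linear_eq_on_span[OF linear _ _ that])
      show "linear (\<lambda>p. \<Sum>\<xi>\<in>\<Xi>. w \<xi> * peval p \<xi>)"
        by (intro linearI) (simp_all add: distrib_left sum.distrib sum_distrib_left mult_ac)
      show "L r = (\<Sum>\<xi>\<in>\<Xi>. w \<xi> * peval r \<xi>)" if "r \<in> products E" for r
        using that Lpq by (auto simp: products_def simp del: peval_mult)
    qed
    show "p \<in> ideal_gen K" if "\<And>\<xi>. \<xi> \<in> \<Xi> \<Longrightarrow> peval p \<xi> = 0" for p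
    proof -
      have "\<phi> p = 0" using that by (simp add: \<phi>_def)
      then show ?thesis using ideal[of p] by simp
    qed
  qed (rule \<Xi>)
qed

end

section \<open>Linear forms and sums of squares\<close>

text \<open>Composing with a projection onto \<open>V\<close> turns the extension by 0, which is rarely linear, into
  a linear one.\<close>

lemma dual_linear_extension:
  assumes "\<Lambda> \<in> dual V" "subspace V"
  obtains L where "linear L" "\<And>p. p \<in> V \<Longrightarrow> L p = \<Lambda> p"
proof -
  obtain P where P: "range P \<subseteq> V" "linear P" "\<forall>v\<in>V. P (id v) = v"
    using linear_exists_left_inverse_on[OF linear_id assms(2) inj_on_id] by blast
  have "P v \<in> V" for v using P(1) by blast
  then have "linear (\<lambda>v. \<Lambda> (P v))"
    using assms(1) by (intro linearI) (simp_all add: dual_def linear_add[OF P(2)] linear_scale[OF P(2)])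
  then show thesis using that P(3) by simp
qed

text \<open>Compared with \<^const>\<open>psd_forms\<close>, the forms are linear on all polynomials, and the normalization
  \<open>L 1 = 1\<close> is dropped: the form that separates a polynomial from the sums of squares may vanish at 1.\<close>

definition moment_cone :: "'n rpoly set \<Rightarrow> 'n rpoly set \<Rightarrow> ('n rpoly \<Rightarrow> real) set" where
  "moment_cone G E = {L. linear L \<and> (\<forall>g\<in>G. L g = 0) \<and> (\<forall>p\<in>E. 0 \<le> L (p * p))}"

lemma moment_cone_add: "L \<in> moment_cone G E \<Longrightarrow> M \<in> moment_cone G E \<Longrightarrow> (\<lambda>p. L p + M p) \<in> moment_cone G E"
  by (auto simp: moment_cone_def intro: linear_compose_add)

lemma moment_cone_scale: "0 \<le> c \<Longrightarrow> L \<in> moment_cone G E \<Longrightarrow> (\<lambda>p. c * L p) \<in> moment_cone G E"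
  using linear_compose_scale_right[of L c] by (auto simp: moment_cone_def)

lemma moment_cone_restrict:
  assumes "L \<in> moment_cone G E" "L 1 = 1" "1 \<in> E" "G \<subseteq> span (products E)"
  shows "(\<lambda>p. if p \<in> span (products E) then L p else 0) \<in> psd_forms G E"
proof -
  have L: "linear L" using assms(1) by (simp add: moment_cone_def)
  have "p * p \<in> span (products E)" if "p \<in> E" for p
    using that by (intro span_base) (auto simp: products_def)
  moreover from this[of 1] have "1 \<in> span (products E)" using assms(3) by simp
  ultimately show ?thesis
    using assms
    by (auto simp: psd_forms_def dual_def moment_cone_def power2_eq_square span_add span_scale
        linear_add[OF L] linear_scale[OF L] subset_iff)
qed

lemma psd_forms_extend:
  assumes "\<Lambda> \<in> psd_forms G E" "1 \<in> E" "G \<subseteq> span (products E)"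
  obtains L where "L \<in> moment_cone G E" "L 1 = 1" "\<And>p. p \<in> span (products E) \<Longrightarrow> L p = \<Lambda> p"
proof -
  obtain L where L: "linear L" "\<And>p. p \<in> span (products E) \<Longrightarrow> L p = \<Lambda> p"
    using assms(1) dual_linear_extension[of \<Lambda> "span (products E)"] by (auto simp: psd_forms_def)
  have sq: "p * p \<in> span (products E)" if "p \<in> E" for p
    using that by (intro span_base) (auto simp: products_def)
  have "1 \<in> span (products E)" using sq[OF assms(2)] by simp
  then show thesis
    using that[of L] L assms sq
    by (simp add: psd_forms_def moment_cone_def power2_eq_square subset_iff)
qed

text \<open>The lists of squares are concatenated; the summands in \<open>span G\<close> add up within \<open>span G\<close>.\<close>

lemma sos_set_add:
  assumes "p \<in> sos_set (span G) E" "q \<in> sos_set (span G) E"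
  shows "p + q \<in> sos_set (span G) E"
proof -
  obtain s :: nat and h g where p: "\<forall>i\<in>{1..s}. h i \<in> E" "g \<in> span G" "p = (\<Sum>i=1..s. (h i)\<^sup>2) + g"
    using assms(1) unfolding sos_set_def by blast
  obtain s' :: nat and h' g' where q: "\<forall>i\<in>{1..s'}. h' i \<in> E" "g' \<in> span G" "q = (\<Sum>i=1..s'. (h' i)\<^sup>2) + g'"
    using assms(2) unfolding sos_set_def by blast
  define k where "k i = (if i \<le> s then h i else h' (i - s))" for i
  have "(\<Sum>i=1..s + s'. (k i)\<^sup>2) = (\<Sum>i=1..s. (k i)\<^sup>2) + (\<Sum>i=s + 1..s + s'. (k i)\<^sup>2)"
    by (rule sum.ub_add_nat) simp
  also have "(\<Sum>i=1..s. (k i)\<^sup>2) = (\<Sum>i=1..s. (h i)\<^sup>2)"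
    by (intro sum.cong) (auto simp: k_def)
  also have "(\<Sum>i=s + 1..s + s'. (k i)\<^sup>2) = (\<Sum>i=1..s'. (h' i)\<^sup>2)"
    by (rule sum.reindex_bij_witness[of _ "\<lambda>i. i + s" "\<lambda>i. i - s"]) (auto simp: k_def)
  finally have "p + q = (\<Sum>i=1..s + s'. (k i)\<^sup>2) + (g + g')" using p q by (simp add: algebra_simps)
  moreover have "k i \<in> E" if "i \<in> {1..s + s'}" for i
  proof (cases "i \<le> s")
    case False
    then have "i - s \<in> {1..s'}" using that by auto
    then show ?thesis using q(1) False by (simp add: k_def)
  qed (use p(1) that in \<open>simp add: k_def\<close>)
  moreover have "g + g' \<in> span G" using p q by (simp add: span_add)
  ultimately show ?thesis unfolding sos_set_def by blast
qed

lemma sos_set_scale: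
  assumes "0 \<le> c" "p \<in> sos_set (span G) E" "subspace E"
  shows "c *\<^sub>R p \<in> sos_set (span G) E"
proof -
  obtain s :: nat and h g where p: "\<forall>i\<in>{1..s}. h i \<in> E" "g \<in> span G" "p = (\<Sum>i=1..s. (h i)\<^sup>2) + g"
    using assms(2) unfolding sos_set_def by blast
  have "c *\<^sub>R p = (\<Sum>i=1..s. (sqrt c *\<^sub>R h i)\<^sup>2) + c *\<^sub>R g"
    using assms(1) by (simp add: p scaleR_add_right scaleR_sum_right power2_eq_square)
  moreover have "\<forall>i\<in>{1..s}. sqrt c *\<^sub>R h i \<in> E" using p(1) assms(3) by (simp add: subspace_scale)
  moreover have "c *\<^sub>R g \<in> span G" using p by (simp add: span_scale)
  ultimately show ?thesis unfolding sos_set_def by (intro CollectI exI[of _ s] exI conjI) 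
qed

lemma sos_set_square: "p \<in> E \<Longrightarrow> p * p \<in> sos_set (span G) E"
  unfolding sos_set_def
  by (intro CollectI exI[of _ 1] exI[of _ "\<lambda>_. p"] exI[of _ 0]) (simp add: power2_eq_square span_zero)

lemma sos_set_span: "g \<in> span G \<Longrightarrow> g \<in> sos_set (span G) E"
  unfolding sos_set_def
  by (intro CollectI exI[of _ 0] exI[of _ "\<lambda>_. 0"] exI[of _ g]) simp

lemma sos_set_sum:
  assumes "\<And>i. i \<in> I \<Longrightarrow> p i \<in> sos_set (span G) E"
  shows "(\<Sum>i\<in>I. p i) \<in> sos_set (span G) E"
  using assms by (induction I rule: infinite_finite_induct) (auto intro: sos_set_add sos_set_span span_zero)

text \<open>For \<open>b, b' \<in> P\<close> and the sum \<open>e\<close> of the squares of all elements of \<open>P\<close>, the polynomial \<open>e + b * b'\<close> is half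
  of \<open>(b + b')\<^sup>2 + (e - b\<^sup>2) + (e - b'\<^sup>2)\<close>, and similarly for \<open>e - b * b'\<close>. The products \<open>b * b'\<close> span, so a multiple
  of \<open>e\<close> dominates every polynomial in their span.\<close>

lemma sum_squares_order_unit:
  assumes "finite P" and v: "v \<in> span (products P)"
  shows "\<exists>t. t *\<^sub>R (\<Sum>b\<in>P. b * b) + v \<in> sos_set (span G) (span P)"
proof -
  let ?C = "sos_set (span G) (span P)"
  define e where "e = (\<Sum>b\<in>P. b * b)"
  have e: "e - b * b \<in> ?C" if "b \<in> P" for b
  proof -
    have "e - b * b = (\<Sum>b\<in>P - {b}. b * b)" using assms(1) that by (simp add: e_def sum_diff1)
    also have "\<dots> \<in> ?C" by (intro sos_set_sum sos_set_square span_base) auto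
    finally show ?thesis .
  qed
  have half: "e + c *\<^sub>R (b * b') \<in> ?C" if b: "b \<in> P" "b' \<in> P" and c: "c = 1 \<or> c = -1" for b b' c
  proof -
    have "(b + c *\<^sub>R b') * (b + c *\<^sub>R b') \<in> ?C"
      using b by (intro sos_set_square) (simp add: span_add span_scale span_base)
    then have "(1/2) *\<^sub>R ((b + c *\<^sub>R b') * (b + c *\<^sub>R b') + ((e - b * b) + (e - b' * b'))) \<in> ?C"
      using e b by (intro sos_set_scale sos_set_add) simp_all
    moreover have "(b + c *\<^sub>R b') * (b + c *\<^sub>R b')
        = b * b + c *\<^sub>R (b * b') + c *\<^sub>R (b * b') + (c * c) *\<^sub>R (b' * b')"
      by (simp only: distrib_left distrib_right mult_scaleR_left_rpoly mult_scaleR_right_rpoly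
          scaleR_scaleR scaleR_add_right mult.commute[of b' b] add.assoc)
    moreover have "(c * c) *\<^sub>R (b' * b') = b' * b'" using c by auto
    moreover have "x + z + z + y + ((e - x) + (e - y)) = 2 *\<^sub>R (e + z)" for x y z
      by (simp add: scaleR_2)
    ultimately have "(1/2) *\<^sub>R (2 *\<^sub>R (e + c *\<^sub>R (b * b'))) \<in> ?C" by (simp only:)
    then show ?thesis by simp
  qed
  have "\<exists>t. t *\<^sub>R e + v \<in> ?C" using v
  proof (induction rule: span_induct_alt)
    case base
    then show ?case by (intro exI[of _ 0]) (simp add: sos_set_span span_zero)
  next
    case (step c x y)
    then obtain b b' t where bt: "b \<in> P" "b' \<in> P" "x = b * b'" "t *\<^sub>R e + y \<in> ?C"
      by (auto simp: products_def)
    have "\<bar>c\<bar> *\<^sub>R (e + sgn c *\<^sub>R x) \<in> ?C"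
    proof (cases "c = 0")
      case False
      then show ?thesis
        unfolding bt(3) by (intro sos_set_scale half bt(1,2)) (auto simp: sgn_if)
    qed (simp add: sos_set_span span_zero)
    then have "\<bar>c\<bar> *\<^sub>R e + c *\<^sub>R x \<in> ?C" by (simp add: scaleR_add_right abs_mult_sgn)
    from sos_set_add[OF this bt(4)] have "(\<bar>c\<bar> + t) *\<^sub>R e + (c *\<^sub>R x + y) \<in> ?C"
      by (simp add: algebra_simps)
    then show ?case by blast
  qed
  then show ?thesis by (simp add: e_def)
qed

section \<open>Generic optimal flat forms\<close>

text \<open>A flat form \<open>L\<close> that is optimal for \<open>f\<close> and generic, given as a linear form on all polynomials. The
  competitors \<open>M\<close> are total linear forms as well; their restrictions to the span of the products are the
  elements of \<^const>\<open>psd_forms\<close>.\<close>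

locale generic_flat_form =
  fixes f :: "'n::finite rpoly" and B G :: "'n rpoly set" and L :: "'n rpoly \<Rightarrow> real"
  assumes attained: "\<exists>x0. \<forall>x. peval f x0 \<le> peval f x"
    and finite_B: "finite B" and connected_B: "connected_to_1 B"
    and f: "f \<in> span (products (span (plus_set B)))"
    and G: "G \<subseteq> span (products (span (plus_set B))) \<inter> I_min f"
    and L: "L \<in> moment_cone G (span (plus_set B))" and L1: "L 1 = 1"
    and optimal: "\<And>M. M \<in> moment_cone G (span (plus_set B)) \<Longrightarrow> M 1 = 1 \<Longrightarrow> L f \<le> M f"
    and generic: "\<And>M. M \<in> moment_cone G (span (plus_set B)) \<Longrightarrow> M 1 = 1 \<Longrightarrow> M f = L f \<Longrightarrow>
      hankel_rank (span (plus_set B)) M \<le> hankel_rank (span (plus_set B)) L"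
    and rank_E: "hankel_rank (span (plus_set B)) L = card B"
    and rank_A: "hankel_rank (span B) L = card B"
begin

abbreviation "A \<equiv> span B"
abbreviation "E \<equiv> span (plus_set B)"
abbreviation "K \<equiv> hankel_ker E L"

lemma L_linear: "linear L" and L_psd: "p \<in> E \<Longrightarrow> 0 \<le> L (p * p)"
  using L by (auto simp: moment_cone_def)

lemma B_subset_plus_set: "B \<subseteq> plus_set B"
  by (auto simp: plus_set_def)

lemma A_sub_E: "A \<subseteq> E"
  by (intro span_mono B_subset_plus_set)

lemma one_in_E: "1 \<in> E"
  using connected_B B_subset_plus_set by (intro span_base) (auto simp: connected_to_1_def)

lemma independent_B: "independent B" and inj_A: "inj_on (hankel A L) A"
  using dim_image_eq_card_imp[OF linear_hankel[OF L_linear] finite_B] rank_A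
  by (simp_all add: hankel_rank_def)

lemma L_nondegenerate: "p \<in> A \<Longrightarrow> (\<And>q. q \<in> A \<Longrightarrow> L (p * q) = 0) \<Longrightarrow> p = 0"
proof -
  assume p: "p \<in> A" and "\<And>q. q \<in> A \<Longrightarrow> L (p * q) = 0"
  then have "hankel A L p = 0" by (simp add: hankel_def fun_eq_iff)
  also have "0 = hankel A L 0" by (simp add: linear_0[OF linear_hankel[OF L_linear]])
  finally show "p = 0" using inj_A p by (simp add: inj_on_eq_iff span_zero)
qed

lemma A_Int_K: "p \<in> A \<Longrightarrow> p \<in> K \<Longrightarrow> p = 0"
  using A_sub_E by (intro L_nondegenerate) (auto simp: hankel_ker_def)

text \<open>A kernel inside \<open>K\<close> meets \<open>A\<close> only in 0. So \<open>A\<close> already has an image of dimension \<open>card B\<close>, which the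
  rank bound makes the whole image.\<close>

lemma hankel_eq_on_A:
  assumes M: "linear M" and ker: "\<And>p. p \<in> E \<Longrightarrow> hankel E M p = 0 \<Longrightarrow> p \<in> K"
    and rank: "hankel_rank E M \<le> card B" and p: "p \<in> E"
  shows "\<exists>a\<in>A. hankel E M p = hankel E M a"
proof -
  have H: "linear (hankel E M)" by (rule linear_hankel[OF M])
  have "inj_on (hankel E M) A"
    using ker A_sub_E A_Int_K by (subst linear_injective_on_subspace_0[OF H]) auto
  then have "hankel E M ` E \<subseteq> hankel E M ` A"
    using rank independent_B finite_B B_subset_plus_set
    by (intro image_span_subset_if_dim_le[OF H]) (simp_all add: finite_plus_set hankel_rank_def)
  then show ?thesis using p by blast
qed

sublocale extension: flat_form B L
proof
  show "0 < L (p * p)" if "p \<in> A" "p \<noteq> 0" for p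
  proof (rule ccontr)
    assume "\<not> 0 < L (p * p)"
    then have "L (p * q) = 0" if "q \<in> A" for q
      using that \<open>p \<in> A\<close> A_sub_E L_psd
      by (intro psd_cauchy_schwarz_null[OF L_linear subspace_span[of B]]) auto
    then show False using L_nondegenerate that by blast
  qed
  show "\<exists>a\<in>A. p - a \<in> K" if p: "p \<in> E" for p
  proof -
    obtain a where a: "a \<in> A" "hankel E L p = hankel E L a"
      using hankel_eq_on_A[OF L_linear _ _ p] rank_E by (auto simp: hankel_ker_eq)
    moreover have "p - a \<in> E" using p a(1) A_sub_E by (auto intro: span_diff)
    ultimately show ?thesis
      by (auto simp: hankel_ker_eq linear_diff[OF linear_hankel[OF L_linear]])
  qed
qed (simp_all add: finite_B connected_B linear_add[OF L_linear] linear_scale[OF L_linear])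

text \<open>Genericity. If \<open>M f = M 1 * L f\<close>, then the normalized sum \<open>N\<close> of \<open>L\<close> and \<open>M\<close> is again optimal. Its kernel
  lies in \<open>K\<close>, since for sums of positive semidefinite forms the kernels intersect. Its rank does not
  exceed that of \<open>L\<close>, so its kernel is all of \<open>K\<close>, and \<open>M\<close> vanishes on \<open>K\<close> times \<open>E\<close> along with \<open>L\<close> and \<open>N\<close>.\<close>

lemma K_in_kernel:
  assumes M: "M \<in> moment_cone G E" and Mf: "M f = M 1 * L f" and p: "p \<in> K" and q: "q \<in> E"
  shows "M (p * q) = 0"
proof -
  have Mlin: "linear M" and Mpsd: "\<And>p. p \<in> E \<Longrightarrow> 0 \<le> M (p * p)"
    using M by (auto simp: moment_cone_def)
  have M1: "0 \<le> M 1" using Mpsd[OF one_in_E] by simp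
  define N where "N p = 1 / (1 + M 1) * (L p + M p)" for p
  have N: "N \<in> moment_cone G E"
    unfolding N_def using M1 by (intro moment_cone_scale moment_cone_add L M) simp
  have Nlin: "linear N" using N by (simp add: moment_cone_def)
  have N1: "N 1 = 1" using M1 by (simp add: N_def L1)
  have "L f + M 1 * L f = (1 + M 1) * L f" by (simp add: algebra_simps)
  then have Nf: "N f = L f" using M1 by (simp add: N_def Mf)
  have ker: "p \<in> K" if p: "p \<in> E" and zero: "hankel E N p = 0" for p
  proof -
    have "N (p * p) = 0" using p zero by (auto simp: hankel_def fun_eq_iff split: if_splits)
    then have "L (p * p) \<le> 0" using M1 Mpsd[OF p] by (simp add: N_def)
    then have "L (p * q) = 0" if "q \<in> E" for q
      using psd_cauchy_schwarz_null[OF L_linear subspace_span[of "plus_set B"]] L_psd p that by blast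
    then show ?thesis using p by (simp add: hankel_ker_def)
  qed
  have pE: "p \<in> E" using p by (simp add: hankel_ker_def)
  obtain a where a: "a \<in> A" "hankel E N p = hankel E N a"
    using hankel_eq_on_A[OF Nlin ker _ pE] generic[OF N N1 Nf] rank_E by auto
  have "hankel E N (p - a) = 0" using a by (simp add: linear_diff[OF linear_hankel[OF Nlin]])
  moreover have "p - a \<in> E" using pE a(1) A_sub_E by (auto intro: span_diff)
  ultimately have "p - a \<in> K" by (intro ker)
  have H: "linear (hankel E L)" by (rule linear_hankel[OF L_linear])
  have "hankel E L a = 0"
    using \<open>p - a \<in> K\<close> p by (simp add: hankel_ker_eq linear_diff[OF H])
  then have "a = 0" using a(1) A_sub_E by (intro A_Int_K) (auto simp: hankel_ker_eq)
  then have "hankel E N p = 0" using a by (simp add: linear_0[OF linear_hankel[OF Nlin]])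
  then have "N (p * q) = 0" using q by (auto simp: hankel_def fun_eq_iff split: if_splits)
  moreover have "L (p * q) = 0" using p q by (simp add: hankel_ker_def)
  ultimately show ?thesis using M1 by (simp add: N_def)
qed

lemma min_value_le: "min_value f \<le> peval f x"
  unfolding min_value_def using attained by (intro cINF_lower) (auto simp: bdd_below_def)

lemma minimizer_exists: "\<exists>x. peval f x = min_value f"
proof -
  obtain x where "\<forall>y. peval f x \<le> peval f y" using attained by blast
  then have "peval f x \<le> min_value f" unfolding min_value_def by (intro cINF_greatest) auto
  then show ?thesis using min_value_le[of x] by (intro exI[of _ x]) simp
qed

lemma eval_in_moment_cone:
  assumes "peval f x = min_value f"
  shows "(\<lambda>p. peval p x) \<in> moment_cone G E"
  using assms G linear_peval[of x] by (auto simp: moment_cone_def I_min_def)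

text \<open>The atomic representation makes \<open>L f\<close> an average of values of \<open>f\<close>, so \<open>L f\<close> is at least the minimum;
  evaluation at a minimizer is a competitor and gives the converse. Equality forces every atom to be
  a minimizer. Hence a polynomial that vanishes at all minimizers vanishes at all atoms.\<close>

lemma L_f_eq_min_value: "L f = min_value f"
  and I_min_subset: "I_min f \<subseteq> ideal_gen K"
proof -
  obtain x where x: "peval f x = min_value f" using minimizer_exists by blast
  have le: "L f \<le> min_value f" using optimal[OF eval_in_moment_cone[OF x]] x by simp
  obtain \<Xi> w where \<Xi>: "finite \<Xi>" and w: "\<And>\<xi>. \<xi> \<in> \<Xi> \<Longrightarrow> 0 < w \<xi>"
    and Lw: "\<And>p. p \<in> span (products E) \<Longrightarrow> L p = (\<Sum>\<xi>\<in>\<Xi>. w \<xi> * peval p \<xi>)"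
    and van: "\<And>p. (\<And>\<xi>. \<xi> \<in> \<Xi> \<Longrightarrow> peval p \<xi> = 0) \<Longrightarrow> p \<in> ideal_gen K"
    using extension.atomic_representation by blast
  have "1 * 1 \<in> products E" unfolding products_def using one_in_E by blast
  then have "1 \<in> span (products E)" using span_base by fastforce
  then have "(\<Sum>\<xi>\<in>\<Xi>. w \<xi>) = 1" using Lw[of 1] L1 by simp
  then have gap: "L f - min_value f = (\<Sum>\<xi>\<in>\<Xi>. w \<xi> * (peval f \<xi> - min_value f))"
    using Lw[OF f] by (simp add: right_diff_distrib sum_subtractf flip: sum_distrib_right)
  have nonneg: "0 \<le> w \<xi> * (peval f \<xi> - min_value f)" if "\<xi> \<in> \<Xi>" for \<xi>
    using w[OF that] min_value_le by simp
  then have "0 \<le> L f - min_value f" unfolding gap by (rule sum_nonneg)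
  then show eq: "L f = min_value f" using le by simp
  then have "\<forall>\<xi>\<in>\<Xi>. w \<xi> * (peval f \<xi> - min_value f) = 0"
    using gap nonneg \<Xi> by (simp add: sum_nonneg_eq_0_iff)
  then have "peval f \<xi> = min_value f" if "\<xi> \<in> \<Xi>" for \<xi> using w that by force
  then show "I_min f \<subseteq> ideal_gen K" using van by (auto simp: I_min_def)
qed

text \<open>Evaluation at a minimizer is optimal, so by genericity it vanishes on \<open>K\<close>.\<close>

lemma ideal_gen_K: "ideal_gen K = I_min f"
proof
  have "peval p x = 0" if "p \<in> K" "peval f x = min_value f" for p x
    using K_in_kernel[OF eval_in_moment_cone[OF that(2)] _ that(1) one_in_E] that
    by (simp add: L_f_eq_min_value)
  then show "ideal_gen K \<subseteq> I_min f" by (intro ideal_gen_least) (auto simp: I_min_def)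
qed (rule I_min_subset)

text \<open>Adding multiples of such an \<open>M\<close> to \<open>L\<close> keeps a form optimal, so this excludes unbounded directions in
  the set of optimal forms. By genericity \<open>M\<close> vanishes on \<open>K\<close> times \<open>E\<close>, and \<open>M 1 = 0\<close> puts 1 into the kernel
  of \<open>M\<close>. Connectedness spreads this to all of \<open>B\<close>: if \<open>m\<close> is in the kernel and \<open>a \<in> A\<close>, then
  \<open>M (pvar i * m * a) = M (m * (pvar i * a)) = 0\<close> because \<open>pvar i * a \<in> E\<close>. As \<open>E = A + K\<close>, nothing is left.\<close>

lemma recession_trivial:
  assumes M: "M \<in> moment_cone G E" and M1: "M 1 = 0" and Mf: "M f \<le> 0" and p: "p \<in> span (products E)"
  shows "M p = 0"
proof -
  have Mlin: "linear M" and Mpsd: "\<And>p. p \<in> E \<Longrightarrow> 0 \<le> M (p * p)"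
    using M by (auto simp: moment_cone_def)
  have "L f \<le> L f + M f" using optimal[OF moment_cone_add[OF L M]] by (simp add: L1 M1)
  then have "M f = M 1 * L f" using Mf M1 by simp
  then have MK: "M (k * q) = 0" if "k \<in> K" "q \<in> E" for k q using K_in_kernel[OF M] that by blast
  have MA: "M (a * q) = 0" if "a \<in> A" "\<And>m. m \<in> B \<Longrightarrow> M (m * q) = 0" for a q
    using that(1)
  proof (induction rule: span_induct_alt)
    case (step c x y)
    then show ?case using that(2) by (simp add: distrib_right linear_add[OF Mlin] linear_scale[OF Mlin])
  qed (simp add: linear_0[OF Mlin])
  have split: "M (m * q) = 0" if "q \<in> E" "m \<in> E" "\<And>a. a \<in> A \<Longrightarrow> M (m * a) = 0" for m q
  proof -
    obtain a where a: "a \<in> A" "q - a \<in> K" using extension.flat \<open>q \<in> E\<close> by blast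
    have "m * q = (q - a) * m + m * a" by (simp add: algebra_simps)
    then have "M (m * q) = M ((q - a) * m) + M (m * a)" by (simp only: linear_add[OF Mlin])
    then show ?thesis using MK[OF a(2) that(2)] that(3)[OF a(1)] by simp
  qed
  have MB: "\<forall>q\<in>E. M (m * q) = 0" if "m \<in> B" for m
    using connected_B that
  proof (induction rule: connected_to_1_induct)
    case one
    show ?case
      using psd_cauchy_schwarz_null[OF Mlin subspace_span[of "plus_set B"] Mpsd one_in_E] M1 by simp
  next
    case (pvar i m)
    show ?case
    proof
      fix q assume "q \<in> E"
      moreover have "pvar i * m \<in> E" using pvar B_subset_plus_set by (auto intro: span_base)
      moreover have "M (pvar i * m * a) = 0" if "a \<in> A" for a
      proof -
        have "M (m * (pvar i * a)) = 0" using pvar(3) extension.pvar_mult_in_E[OF that] by blast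
        moreover have "pvar i * m * a = m * (pvar i * a)" by (simp only: mult_ac)
        ultimately show ?thesis by (simp only:)
      qed
      ultimately show "M (pvar i * m * q) = 0" by (rule split)
    qed
  qed
  have "M (p * q) = 0" if p: "p \<in> E" and q: "q \<in> E" for p q
  proof (rule split[OF q p])
    fix a assume "a \<in> A"
    then have "M (a * p) = 0" using MA MB p by blast
    then show "M (p * a) = 0" by (simp only: mult.commute)
  qed
  then show ?thesis
    by (intro linear_eq_0_on_span[OF Mlin _ p]) (auto simp: products_def)
qed

text \<open>A form \<open>M\<close> that separates \<open>f - c\<close> from the cone of sums of squares modulo \<open>span G\<close> satisfies \<open>M f \<le> c * M 1\<close>.
  If \<open>M 1 > 0\<close>, then normalizing it contradicts the optimality of \<open>L\<close>. If \<open>M 1 = 0\<close>, the case in which a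
  duality gap could arise, then \<open>M\<close> vanishes on all products, although it equals 1 at the order unit.\<close>

lemma sos_below_min:
  assumes c: "c < L f"
  shows "f - Poly_Mapping.single 0 c \<in> sos_set (span G) E"
proof (rule ccontr)
  let ?P = "plus_set B" and ?C = "sos_set (span G) E"
  let ?e = "\<Sum>b\<in>?P. b * b" and ?z = "f - Poly_Mapping.single 0 c"
  assume z: "?z \<notin> ?C"
  have V: "span (products E) = span (products ?P)" by (rule span_products_span)
  have sqV: "p * p \<in> span (products E)" if "p \<in> E" for p
    using that by (intro span_base) (auto simp: products_def)
  have zV: "?z \<in> span (products ?P)"
    using f sqV[OF one_in_E] unfolding V const_eq_scaleR_1 by (auto intro: span_diff span_scale)
  obtain M :: "'n rpoly \<Rightarrow> real" where M: "linear M" "M ?e = 1" "M ?z \<le> 0"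
    and pos: "\<And>p. p \<in> ?C \<Longrightarrow> p \<in> span (products ?P) \<Longrightarrow> 0 \<le> M p"
  proof (rule cone_separation[of "products ?P" ?e ?C ?z])
    note found = that
    show thesis if "linear M" "M ?e = 1" "\<And>p. p \<in> ?C \<Longrightarrow> p \<in> span (products ?P) \<Longrightarrow> 0 \<le> M p"
      "M ?z \<le> 0" for M :: "'n rpoly \<Rightarrow> real"
      using that by (intro found[of M])
    show "?e \<in> ?C" by (intro sos_set_sum sos_set_square span_base)
    show "\<exists>t. t *\<^sub>R ?e + v \<in> ?C" if "v \<in> span (products ?P)" for v
      using that finite_B by (intro sum_squares_order_unit) (simp_all add: finite_plus_set)
  qed (use finite_B z zV in \<open>auto simp: finite_products finite_plus_set
      intro: sos_set_span span_zero sos_set_add sos_set_scale\<close>)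
  have "M g = 0" if "g \<in> G" for g
  proof -
    have gV: "g \<in> span (products ?P)" using G that V by blast
    have "g \<in> ?C" "- g \<in> ?C" using that by (auto intro: sos_set_span span_base span_neg)
    then have "0 \<le> M g" "0 \<le> M (- g)" using pos gV span_neg by blast+
    then show ?thesis by (simp add: linear_neg[OF M(1)])
  qed
  moreover have "0 \<le> M (p * p)" if "p \<in> E" for p
    using pos[OF sos_set_square[OF that]] sqV[OF that] V by simp
  ultimately have Mc: "M \<in> moment_cone G E" using M(1) by (simp add: moment_cone_def)
  have M1: "0 \<le> M 1" using Mc one_in_E by (force simp: moment_cone_def)
  have Mf: "M f \<le> c * M 1"
    using M(3) unfolding const_eq_scaleR_1 by (simp add: linear_diff[OF M(1)] linear_scale[OF M(1)])
  show False
  proof (cases "M 1 = 0")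
    case True
    have "?e \<in> span (products E)" by (intro span_sum sqV span_base)
    then have "M ?e = 0" using recession_trivial[OF Mc True] Mf True by simp
    then show False using M(2) by simp
  next
    case False
    then have "0 < M 1" using M1 by simp
    then have "L f \<le> 1 / M 1 * M f"
      by (intro optimal[of "\<lambda>p. 1 / M 1 * M p"] moment_cone_scale Mc) simp_all
    then have "L f * M 1 \<le> M f" using \<open>0 < M 1\<close> by (simp add: field_simps)
    then have "L f * M 1 \<le> c * M 1" using Mf by simp
    then show False using c \<open>0 < M 1\<close> by simp
  qed
qed

lemma sos_imp_le_min:
  assumes "f - Poly_Mapping.single 0 c \<in> sos_set (span G) E"
  shows "c \<le> L f"
proof -
  obtain s :: nat and h g where h: "\<forall>i\<in>{1..s}. h i \<in> E" "g \<in> span G"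
    and eq: "f - Poly_Mapping.single 0 c = (\<Sum>i=1..s. (h i)\<^sup>2) + g"
    using assms unfolding sos_set_def by blast
  have "L g = 0"
    using L by (intro linear_eq_0_on_span[OF L_linear _ h(2)]) (auto simp: moment_cone_def)
  then have "L f - c = (\<Sum>i=1..s. L ((h i)\<^sup>2))"
    using arg_cong[OF eq, of L]
    by (simp add: const_eq_scaleR_1 linear_diff[OF L_linear] linear_add[OF L_linear]
        linear_scale[OF L_linear] linear_sum[OF L_linear] L1)
  also have "\<dots> \<ge> 0" using h(1) L_psd by (intro sum_nonneg) (simp add: power2_eq_square)
  finally show ?thesis by simp
qed

lemma f_sos_eq: "f_sos (span G) E f = ereal (L f)"
  unfolding f_sos_def
proof (rule antisym)
  show "Sup {ereal c | c. f - Poly_Mapping.single 0 c \<in> sos_set (span G) E} \<le> ereal (L f)"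
    using sos_imp_le_min by (auto intro!: Sup_least)
  show "ereal (L f) \<le> Sup {ereal c | c. f - Poly_Mapping.single 0 c \<in> sos_set (span G) E}"
  proof (rule ccontr)
    assume "\<not> ?thesis"
    then obtain c where c: "Sup {ereal c | c. f - Poly_Mapping.single 0 c \<in> sos_set (span G) E} < ereal c"
      "ereal c < ereal (L f)"
      using ereal_dense2 by (meson not_le)
    then have "ereal c \<le> Sup {ereal c | c. f - Poly_Mapping.single 0 c \<in> sos_set (span G) E}"
      using sos_below_min by (intro Sup_upper) auto
    then show False using c(1) by simp
  qed
qed

end

section \<open>Exactness of the relaxations\<close>

theorem theorem4p5:
  fixes f :: "'n::finite rpoly"
    and B G E :: "'n rpoly set"
    and \<Lambda> :: "'n rpoly \<Rightarrow> real"
  assumes "\<exists>x0. \<forall>x. peval f x0 \<le> peval f x"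
    and "finite B" and "connected_to_1 B"
    and "E = span (plus_set B)"
    and "f \<in> span (products E)"
    and "G \<subseteq> span (products (plus_set B)) \<inter> I_min f"
    and "generic_for G E f \<Lambda>"
    and "hankel_rank (span (plus_set B)) \<Lambda> = hankel_rank (span B) \<Lambda>"
    and "hankel_rank (span B) \<Lambda> = card B"
  shows "ereal (min_value f) = f_mu G E f \<and>
         f_mu G E f = f_sos (span G) E f \<and>
         ideal_gen (hankel_ker (span (plus_set B)) \<Lambda>) = I_min f"
proof -
  have V: "span (products E) = span (products (plus_set B))"
    unfolding assms(4) by (rule span_products_span)
  have sub: "span B \<subseteq> E" unfolding assms(4) by (intro span_mono) (auto simp: plus_set_def)
  have one: "1 \<in> E" using assms(3) sub by (auto simp: connected_to_1_def intro: span_base)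
  have GV: "G \<subseteq> span (products E)" using assms(6) V by blast
  have \<Lambda>: "\<Lambda> \<in> psd_forms G E" "ereal (\<Lambda> f) = f_mu G E f"
    and gen: "\<And>\<Lambda>'. \<Lambda>' \<in> psd_forms G E \<Longrightarrow> ereal (\<Lambda>' f) = f_mu G E f \<Longrightarrow>
      hankel_rank E \<Lambda>' \<le> hankel_rank E \<Lambda>"
    using assms(7) by (auto simp: generic_for_def)
  obtain L where L: "L \<in> moment_cone G E" "L 1 = 1" and L\<Lambda>: "\<And>p. p \<in> span (products E) \<Longrightarrow> L p = \<Lambda> p"
    using psd_forms_extend[OF \<Lambda>(1) one GV] by blast
  have Lf: "L f = \<Lambda> f" by (rule L\<Lambda>[OF assms(5)])
  have rank_L: "hankel_rank W L = hankel_rank W \<Lambda>" if "W \<subseteq> E" for W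
    using hankel_rank_cong[of E L \<Lambda> W] L\<Lambda> that by blast
  \<comment> \<open>\<open>?r M\<close> represents the restriction of \<open>M\<close> to the products, extended by 0 as in \<^const>\<open>dual\<close>.\<close>
  let ?r = "\<lambda>M p. if p \<in> span (products E) then M p else 0"
  have r: "?r M \<in> psd_forms G E" if "M \<in> moment_cone G E" "M 1 = 1" for M
    using moment_cone_restrict[OF that one GV] .
  have rank_r: "hankel_rank E M = hankel_rank E (?r M)" for M
    by (rule hankel_rank_cong[of E]) simp_all
  interpret generic_flat_form f B G L
  proof
    show "L f \<le> M f" if "M \<in> moment_cone G (span (plus_set B))" "M 1 = 1" for M
    proof -
      have "f_mu G E f \<le> ereal (?r M f)" unfolding f_mu_def using that assms(4) by (intro INF_lower r) simp_all
      then show ?thesis using \<Lambda>(2) Lf assms(5) by (metis ereal_less_eq(3))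
    qed
    show "hankel_rank (span (plus_set B)) M \<le> hankel_rank (span (plus_set B)) L"
      if "M \<in> moment_cone G (span (plus_set B))" "M 1 = 1" "M f = L f" for M
    proof -
      have "hankel_rank E (?r M) \<le> hankel_rank E \<Lambda>"
        using that assms(4,5) \<Lambda>(2) Lf by (intro gen r) simp_all
      then show ?thesis using rank_r[of M] rank_L[of E] assms(4) by simp
    qed
    show "hankel_rank (span (plus_set B)) L = card B"
      using rank_L[of E] assms(4,8,9) by simp
    show "hankel_rank (span B) L = card B" using rank_L[OF sub] assms(9) by simp
  qed (use assms L V in auto)
  have "ereal (min_value f) = f_mu G E f" using L_f_eq_min_value Lf \<Lambda>(2) by simp
  moreover have "f_mu G E f = f_sos (span G) E f" using f_sos_eq Lf \<Lambda>(2) assms(4) by simp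
  moreover have "ideal_gen (hankel_ker (span (plus_set B)) \<Lambda>) = I_min f"
    using ideal_gen_K hankel_ker_cong[of E L \<Lambda>] L\<Lambda> assms(4) by simp
  ultimately show ?thesis by blast
qed

end
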